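(* Let $\{\Phi_j\}_{j=1}^J$ be similitudes of $\mathbb{R}^d$ with scaling ratios $0<r_j<1$ and attractor $F$. Suppose the convex hull $C=[F]$ satisfies $\dim C=d$, the open set condition holds with $\operatorname{int} C$ as feasible open set, $\operatorname{int} C\nsubseteq \bigcup_{j=1}^J\Phi_j(C)$, and the similarity dimension $D$ satisfies $d-1<D<d$. Suppose that the associated tiling $\mathcal{T}$ has a single generator $G$, with inradius $g$, and that for some $0<h\le g$ the volume $V_G(\varepsilon)$ of the inner $\varepsilon$-neighborhood of $G$ has the form $$V_G(\varepsilon)=\begin{cases}\displaystyle\sum_{i=0}^{d-1}\kappa_i(G)\,\varepsilon^{d-i}, & 0<\varepsilon<h,\\[2mm] \lambda_G(\varepsilon), & h\le\varepsilon\le g,\end{cases}$$ with real constants $\kappa_i(G)$ and a continuous, piecewise continuously differentiable function $\lambda_G$ on $[h,g]$. Let $\zeta_{\mathcal{T}}(s,\varepsilon)$ be the geometric $\zeta$-function associated with $G$, let $\mathfrak{D}$ be the set of complex dimensions, and let $\mathfrak{D}_{\mathcal{T}}=\mathfrak{D}\cup\{0,1,\dots,d-1\}$. Then $$V_{\mathcal{T}}(\varepsilon)=\sum_{\omega\in\mathfrak{D}_{\mathcal{T}}}\operatorname{res}\bigl(\zeta_{\mathcal{T}}(s,\varepsilon);\omega\bigr)\qquad\text{for } 0<\varepsilon<h.$$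
   Context: Self-similar system: $\Phi_j:\mathbb{R}^d\to\mathbb{R}^d$ ($j=1,\dots,J$) are similitudes with scaling ratios $0<r_j<1$; $F$ is the unique nonempty compact set with $F=\Phi(F)$, where $\Phi(A):=\bigcup_{j=1}^J\Phi_j(A)$. $C=[F]$ is the convex hull of $F$. The open set condition with feasible open set $\operatorname{int} C$ means that $\Phi_j(\operatorname{int}C)\subseteq\operatorname{int}C$ for all $j$ and the sets $\Phi_j(\operatorname{int}C)$ are pairwise disjoint. Tiling: $T_1:=\operatorname{int}(C\setminus\Phi(C))$ and $T_n:=\Phi^{n-1}(T_1)$ for $n\ge 2$; $\mathcal{T}:=\{T_n\}_{n\ge1}$. The connected components of $T_1$ are called generators; "single generator $G$" means $T_1=G$ is connected. Inner neighborhoods: for a bounded open set $A\subset\mathbb{R}^d$, $V_A(\varepsilon)$ is the $d$-dimensional volume of the inner $\varepsilon$-neighborhood of $A$, i.e. of the set of points of $A$ at distance at most $\varepsilon$ from $\partial A$. The inradius $g$ of $G$ is the supremum of the radii of balls contained in $G$; for $\varepsilon\ge g$, $V_G(\varepsilon)=\operatorname{Vol}(G)$. Convention: $\kappa_d(G):=-\operatorname{Vol}(G)$. The volume of the inner $\varepsilon$-neighborhood of the tiling is $V_{\mathcal{T}}(\varepsilon):=\sum_{n=1}^\infty V_{T_n}(\varepsilon)$. Scaling $\zeta$-function: $\zeta(s)=\sum_{k=0}^\infty\sum_{w\in W_k}r_w^s$, where $W_k$ is the set of words $w=w_1\cdots w_k$ of length $k$ over $\{1,\dots,J\}$ and $r_w=r_{w_1}\cdots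 r_{w_k}$ (with $r_w=1$ for the empty word). For $\operatorname{Re}(s)>D$ it equals $\frac{1}{1-\sum_{j=1}^J r_j^s}$, and $\zeta$ also denotes the meromorphic continuation to $\mathbb{C}$ given by this formula. The similarity dimension $D$ is the unique real root of $1-\sum_{j=1}^J r_j^s=0$. The set of complex dimensions is $\mathfrak{D}:=\{\omega\in\mathbb{C}\mid\zeta \text{ has a pole at }\omega\}$. Geometric $\zeta$-function associated with $G$: $$\zeta_{\mathcal{T}}(s,\varepsilon):=\zeta(s)\,\varepsilon^{d-s}\left(\sum_{i=0}^{d-1}\frac{h^{s-i}}{s-i}\kappa_i(G)+\frac{g^{s-d}}{s-d}\kappa_d(G)+\Lambda(s)\right),\qquad \Lambda(s)=\int_h^g u^{s-d-1}\lambda_G(u)\,du,$$ where $\Lambda$ is entire. For fixed $\varepsilon$, $\operatorname{res}(\zeta_{\mathcal{T}}(s,\varepsilon);\omega)$ denotes the residue at $s=\omega$ of this meromorphic function of $s$. *)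

theory Defs
  imports "HOL-Complex_Analysis.Complex_Analysis"
begin

definition similitude :: "real \<Rightarrow> ('a::metric_space \<Rightarrow> 'a) \<Rightarrow> bool" where
  "similitude r f \<longleftrightarrow> (\<forall>x y. dist (f x) (f y) = r * dist x y)"

definition set_map :: "nat \<Rightarrow> (nat \<Rightarrow> 'a \<Rightarrow> 'a) \<Rightarrow> 'a set \<Rightarrow> 'a set" where
  "set_map J \<Phi> A = (\<Union>j\<in>{1..J}. \<Phi> j ` A)"

text \<open>The intended hull is \<open>C = convex hull F\<close>. Tiles are numbered from 1 on.\<close>

definition tile ::
  "nat \<Rightarrow> (nat \<Rightarrow> 'a \<Rightarrow> 'a) \<Rightarrow> 'a::topological_space set \<Rightarrow> nat \<Rightarrow> 'a set" where
  "tile J \<Phi> C n = (set_map J \<Phi> ^^ (n - 1)) (interior (C - set_map J \<Phi> C))"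

definition inner_volume :: "'a::euclidean_space set \<Rightarrow> real \<Rightarrow> real" where
  "inner_volume A \<epsilon> = measure lebesgue {x \<in> A. infdist x (frontier A) \<le> \<epsilon>}"

definition inradius :: "'a::metric_space set \<Rightarrow> real" where
  "inradius A = Sup {\<rho>. \<rho> > 0 \<and> (\<exists>x. ball x \<rho> \<subseteq> A)}"

definition tiling_volume ::
  "nat \<Rightarrow> (nat \<Rightarrow> 'a \<Rightarrow> 'a) \<Rightarrow> 'a::euclidean_space set \<Rightarrow> real \<Rightarrow> real" where
  "tiling_volume J \<Phi> C \<epsilon> = (\<Sum>n. inner_volume (tile J \<Phi> C (Suc n)) \<epsilon>)"

text \<open>The meromorphic continuation of the Dirichlet series over all words; that it agrees with
  the series to the right of the similarity dimension is \<open>scaling_zeta_series\<close> below.\<close>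

definition scaling_zeta :: "nat \<Rightarrow> (nat \<Rightarrow> real) \<Rightarrow> complex \<Rightarrow> complex" where
  "scaling_zeta J r s = 1 / (1 - (\<Sum>j=1..J. of_real (r j) powr s))"

definition words :: "nat \<Rightarrow> nat \<Rightarrow> nat list set" where
  "words J k = {w. set w \<subseteq> {1..J} \<and> length w = k}"

definition word_ratio :: "(nat \<Rightarrow> real) \<Rightarrow> nat list \<Rightarrow> real" where
  "word_ratio r w = prod_list (map r w)"

definition complex_dims :: "nat \<Rightarrow> (nat \<Rightarrow> real) \<Rightarrow> complex set" where
  "complex_dims J r = {\<omega>. is_pole (scaling_zeta J r) \<omega>}"

definition tiling_dims :: "nat \<Rightarrow> (nat \<Rightarrow> real) \<Rightarrow> nat \<Rightarrow> complex set" where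
  "tiling_dims J r d = complex_dims J r \<union> of_nat ` {..<d}"

definition Lambda_integral :: "nat \<Rightarrow> real \<Rightarrow> real \<Rightarrow> (real \<Rightarrow> real) \<Rightarrow> complex \<Rightarrow> complex" where
  "Lambda_integral d h g lam s =
     integral {h..g} (\<lambda>u. of_real u powr (s - of_nat d - 1) * of_real (lam u))"

text \<open>The summand with \<open>s - d\<close> carries \<open>\<kappa>\<^sub>d(G) = - Vol(G)\<close>, so only \<open>\<kappa> i\<close> for \<open>i < d\<close> is used.\<close>

definition geometric_zeta ::
  "nat \<Rightarrow> (nat \<Rightarrow> real) \<Rightarrow> 'a::euclidean_space set \<Rightarrow> real \<Rightarrow> (nat \<Rightarrow> real) \<Rightarrow> (real \<Rightarrow> real)
     \<Rightarrow> complex \<Rightarrow> real \<Rightarrow> complex" where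
  "geometric_zeta J r G h \<kappa> lam s \<epsilon> =
    (let d = DIM('a); g = inradius G in
     scaling_zeta J r s * of_real \<epsilon> powr (of_nat d - s) *
     ((\<Sum>i<d. of_real h powr (s - of_nat i) / (s - of_nat i) * of_real (\<kappa> i))
      + of_real g powr (s - of_nat d) / (s - of_nat d) * of_real (- measure lebesgue G)
      + Lambda_integral d h g lam s))"

lemma word_ratio_pos:
  assumes "\<And>j. j \<in> {1..J} \<Longrightarrow> 0 < r j" "set w \<subseteq> {1..J}"
  shows "0 < word_ratio r w"
  using assms(2) by (induction w) (auto simp: word_ratio_def assms(1))

lemma sum_words_powr:
  assumes r: "\<And>j. j \<in> {1..J} \<Longrightarrow> 0 < r j"
  shows "(\<Sum>w\<in>words J k. of_real (word_ratio r w) powr s)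
    = (\<Sum>j=1..J. of_real (r j) powr (s::complex)) ^ k"
proof (induction k)
  case 0
  have "words J 0 = {[]}" by (auto simp: words_def)
  then show ?case by (simp add: word_ratio_def)
next
  case (Suc k)
  have *: "words J (Suc k) = (\<lambda>(xs, n). n # xs) ` (words J k \<times> {1..J})"
    unfolding words_def by (rule lists_length_Suc_eq)
  have **: "of_real (word_ratio r (n # xs)) powr s
      = of_real (word_ratio r xs) powr s * of_real (r n) powr s"
    if "xs \<in> words J k" "n \<in> {1..J}" for xs n
  proof -
    have "0 < r n" "0 < word_ratio r xs"
      using that r word_ratio_pos[of J r xs] by (auto simp: words_def)
    then show ?thesis
      by (simp add: word_ratio_def powr_times_real mult.commute)
  qed
  have "(\<Sum>w\<in>words J (Suc k). of_real (word_ratio r w) powr s)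
      = (\<Sum>(xs, n)\<in>words J k \<times> {1..J}. of_real (word_ratio r (n # xs)) powr s)"
    unfolding * by (subst sum.reindex) (auto simp: inj_on_def case_prod_unfold)
  also have "\<dots> = (\<Sum>(xs, n)\<in>words J k \<times> {1..J}.
      of_real (word_ratio r xs) powr s * of_real (r n) powr s)"
    by (rule sum.cong) (use ** in auto)
  also have "\<dots> = (\<Sum>w\<in>words J k. of_real (word_ratio r w) powr s)
      * (\<Sum>j=1..J. of_real (r j) powr s)"
    by (simp add: sum_product sum.cartesian_product)
  finally show ?case using Suc.IH by simp
qed

lemma scaling_zeta_series:
  fixes s :: complex
  assumes r: "\<And>j. j \<in> {1..J} \<Longrightarrow> 0 < r j \<and> r j < 1"
    and D: "(\<Sum>j=1..J. r j powr D) = 1" and s: "D < Re s"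
  shows "(\<lambda>k. \<Sum>w\<in>words J k. of_real (word_ratio r w) powr s) sums scaling_zeta J r s"
proof -
  have ne: "{1..J} \<noteq> {}" using D by (metis sum.empty zero_neq_one)
  have "norm (\<Sum>j=1..J. of_real (r j) powr s) \<le> (\<Sum>j=1..J. r j powr Re s)"
    by (rule sum_norm_le) (use r in \<open>auto simp: norm_powr_real_powr less_imp_le\<close>)
  also have "\<dots> < (\<Sum>j=1..J. r j powr D)"
    by (rule sum_strict_mono) (use r s ne in \<open>auto simp: powr_less_cancel_iff powr_less_mono'\<close>)
  finally have "norm (\<Sum>j=1..J. of_real (r j) powr s) < 1" using D by simp
  then show ?thesis
    unfolding scaling_zeta_def using sum_words_powr[of J r] r geometric_sums by force
qed

end

theory Submission
  imports Defs
begin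

text \<open>Let \<open>V\<close> be the inner tube volume of the generator \<open>G\<close>, the distribution function of the distance
  \<open>\<delta>\<close> to \<open>\<partial>G\<close>. The tiles of level \<open>k\<close> are unions of disjoint open copies of \<open>G\<close>, so the tiling volume is
  \<open>\<Sum>\<^sub>w r\<^sub>w\<^sup>d V(\<epsilon>/r\<^sub>w)\<close>. The bracket in the geometric zeta function is
  \<open>B(s) = \<Sum>\<^sub>i \<kappa>\<^sub>i h\<^bsup>s-i\<^esup>/(s-i) + (\<integral>\<^sub>G max(h,\<delta>)\<^bsup>s-d\<^esup>)/(d-s)\<close>, because \<open>\<Lambda>\<close> is an integral of \<open>V\<close> and hence
  of powers of \<open>max(h,\<delta>)\<close>. Every summand is a Perron kernel, so
  \<open>(1/2\<pi>\<i>) \<integral> B(s) u\<^bsup>d-s\<^esup> ds\<close> along a vertical line \<open>Re s = c\<close> with \<open>D < c < d\<close> converges to \<open>V(u)\<close>,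
  boundedly enough to sum over all words; there the level sets of \<open>\<delta>\<close> must be null sets.
  Moving the line to \<open>-\<infinity>\<close> collects the residues: for \<open>\<epsilon> < h\<close> the integrand decays to the left like
  \<open>(h/\<epsilon>)\<^bsup>Re s\<^esup>\<close>, and on suitable horizontal lines \<open>Im s = \<plusminus>\<tau>\<^sub>n\<close> the scaling zeta function is uniformly
  bounded while \<open>B(s) = O(h\<^bsup>Re s\<^esup>/\<tau>\<^sub>n)\<close>.\<close>

section \<open>Shifting a vertical contour to the left\<close>

text \<open>On a vertical line the bracket is controlled only by the reciprocal of the height, which
  is not integrable. Every interchange of integrals and sums is therefore made at a finite height
  \<tau>, and \<tau> tends to infinity afterwards under majorants that do not depend on it. The
  abscissa c has to satisfy three demands. The geometric series over words needs c > D. The Perron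
  kernels have exponents c - i for i < d and d - c, and all of them must be positive, so d - 1 < c <
  d. Then the singularity of the bracket at d is never crossed, which is why d contributes no
  residue. Perron's kernel converges to 1/2 at its jump. A level set of \<delta> with positive
  measure would thus be counted by half, and at u = h one half of V(h) comes from the polynomial
  terms and the other half from the distance integral. The zeros of the denominator of the scaling
  zeta function need not be periodic, so heights that avoid them uniformly cannot be written down;
  they come from compactness of the vertical translates. The residue sum is cut off at these
  heights.\<close>

lemma powr_tendsto_0_at_bot:
  fixes q :: real
  assumes "1 < q"
  shows "((\<lambda>x. q powr x) \<longlongrightarrow> 0) at_bot"
proof -
  have "((\<lambda>x. exp (ln q * x)) \<longlongrightarrow> 0) at_bot"
    by (intro filterlim_compose[OF exp_at_bot] filterlim_tendsto_pos_mult_at_bot[OF tendsto_const])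
      (use assms in \<open>auto simp: filterlim_ident\<close>)
  then show ?thesis using assms by (simp add: powr_def mult.commute)
qed

text \<open>Integrating the majorant \<open>M * q powr x\<close> from minus infinity up to
  \<open>b\<close> gives the right-hand side, so the bound is free of \<open>a\<close> and survives
  moving the left edge to minus infinity.\<close>

lemma contour_integral_horizontal_bound:
  fixes f :: "complex \<Rightarrow> complex"
  assumes ab: "a \<le> b" and q: "1 < q"
    and cont: "continuous_on (closed_segment (Complex a y) (Complex b y)) f"
    and bound: "\<And>x. x \<in> {a..b} \<Longrightarrow> norm (f (Complex x y)) \<le> M * q powr x"
  shows "norm (contour_integral (linepath (Complex a y) (Complex b y)) f) \<le> M * q powr b / ln q"
proof -
  have M: "0 \<le> M"
    using bound[of a] ab norm_ge_zero[of "f (Complex a y)"] q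
    by (smt (verit) atLeastAtMost_iff mult_neg_pos powr_gt_zero)
  have lp: "linepath (Complex a y) (Complex b y) x = Complex (a + (b - a) * x) y" for x
    by (auto simp: linepath_def complex_eq_iff algebra_simps)
  have mem: "a + (b - a) * x \<in> {a..b}" if "x \<in> {0..1}" for x
    using that ab mult_left_mono[of x 1 "b - a"] mult_left_mono[of 0 x "b - a"] by auto
  have "((\<lambda>x. (b - a) * (M * q powr (a + (b - a) * x))) has_integral
      (M * q powr (a + (b - a) * 1) / ln q - M * q powr (a + (b - a) * 0) / ln q)) {0..1}"
  proof (rule fundamental_theorem_of_calculus)
    fix x :: real
    show "((\<lambda>x. M * q powr (a + (b - a) * x) / ln q) has_vector_derivative
        (b - a) * (M * q powr (a + (b - a) * x))) (at x within {0..1})"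
      unfolding has_real_derivative_iff_has_vector_derivative[symmetric]
      unfolding powr_def using q by (auto intro!: derivative_eq_intros)
  qed simp
  from has_integral_integrable[OF this] integral_unique[OF this]
  have int: "(\<lambda>x. (b - a) * (M * q powr (a + (b - a) * x))) integrable_on {0..1}"
    and val: "integral {0..1} (\<lambda>x. (b - a) * (M * q powr (a + (b - a) * x)))
      = M * q powr b / ln q - M * q powr a / ln q"
    by simp_all
  have "contour_integral (linepath (Complex a y) (Complex b y)) f
      = integral {0..1} (\<lambda>x. f (linepath (Complex a y) (Complex b y) x) * (Complex b y - Complex a y))"
    by (simp add: contour_integral_integral)
  also have "norm \<dots> \<le> integral {0..1} (\<lambda>x. (b - a) * (M * q powr (a + (b - a) * x)))"
  proof (rule integral_norm_bound_integral[OF _ int])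
    have "continuous_on {0..1} (\<lambda>x. f (linepath (Complex a y) (Complex b y) x))"
      by (rule continuous_on_compose2[OF cont])
        (auto simp: linepath_image_01[symmetric] intro!: continuous_intros simp del: linepath_image_01)
    then show "(\<lambda>x. f (linepath (Complex a y) (Complex b y) x) * (Complex b y - Complex a y))
        integrable_on {0..1}"
      by (intro integrable_continuous_real continuous_intros)
    fix x :: real assume "x \<in> {0..1}"
    moreover have "norm (Complex b y - Complex a y) = b - a"
      using ab by (simp add: cmod_def)
    ultimately show "norm (f (linepath (Complex a y) (Complex b y) x) * (Complex b y - Complex a y))
        \<le> (b - a) * (M * q powr (a + (b - a) * x))"
      unfolding lp norm_mult using bound[OF mem] ab
      by (simp add: mult.commute mult_left_mono)
  qed
  also have "\<dots> \<le> M * q powr b / ln q"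
    unfolding val using M q by simp
  finally show ?thesis .
qed

text \<open>Residue theorem on rectangles whose left edge \<open>N\<close> tends to minus infinity.
  That edge contributes at most \<open>2 * \<tau> * M' * q powr N\<close>, which vanishes for fixed
  \<tau>, so \<open>M'\<close> drops out; each horizontal edge leaves
  \<open>M * q powr c / ln q\<close>. The margins up to \<open>c'\<close> and \<tau>' provide an
  open region around the closed rectangle.\<close>

lemma contour_shift_left:
  fixes F :: "complex \<Rightarrow> complex"
  assumes fin: "finite pts" and pts: "\<And>p. p \<in> pts \<Longrightarrow> Re p < c \<and> \<bar>Im p\<bar> < \<tau>"
    and c: "c < c'" and \<tau>: "0 < \<tau>" "\<tau> < \<tau>'" and q: "1 < q"
    and hol: "F holomorphic_on ({s. Re s < c' \<and> \<bar>Im s\<bar> < \<tau>'} - pts)"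
    and hor: "\<And>s. Re s \<le> c \<Longrightarrow> \<bar>Im s\<bar> = \<tau> \<Longrightarrow> norm (F s) \<le> M * q powr Re s"
    and left: "\<And>s. Re s \<le> N1 \<Longrightarrow> \<bar>Im s\<bar> \<le> \<tau> \<Longrightarrow> norm (F s) \<le> M' * q powr Re s"
  shows "norm ((\<Sum>p\<in>pts. residue F p) - integral {-\<tau>..\<tau>} (\<lambda>t. F (Complex c t)) / (2 * pi))
    \<le> M * q powr c / (pi * ln q)"
proof -
  define S where "S = {s. Re s < c' \<and> \<bar>Im s\<bar> < \<tau>'}"
  have S: "S = {s. Re s < c'} \<inter> ({s. Im s < \<tau>'} \<inter> {s. - \<tau>' < Im s})"
    by (auto simp: S_def)
  have "open S"
    unfolding S by (intro open_Int open_halfspace_Re_lt open_halfspace_Im_lt open_halfspace_Im_gt)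
  have "convex S"
    unfolding S by (intro convex_Int convex_halfspace_Re_lt convex_halfspace_Im_lt convex_halfspace_Im_gt)
  \<comment> \<open>The difference to be estimated, multiplied by 2 pi i. By the residue theorem it
    is the integral over the three edges other than the right one.\<close>
  define X where "X = 2 * of_real pi * \<i> * (\<Sum>p\<in>pts. residue F p)
    - \<i> * integral {-\<tau>..\<tau>} (\<lambda>t. F (Complex c t))"
  have ev: "norm X \<le> 2 * (M * q powr c / ln q) + 2 * \<tau> * M' * q powr N"
    if N: "N < N1" "N < c" "\<And>p. p \<in> pts \<Longrightarrow> N < Re p" for N
  proof -
    define a1 a2 a3 a4 where "a1 = Complex N (-\<tau>)" and "a2 = Complex c (-\<tau>)"
      and "a3 = Complex c \<tau>" and "a4 = Complex N \<tau>"
    note a_defs = a1_def a2_def a3_def a4_def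
    have rp: "rectpath a1 a3 = linepath a1 a2 +++ linepath a2 a3 +++ linepath a3 a4 +++ linepath a4 a1"
      by (simp add: rectpath_def a_defs Let_def)
    have pim: "path_image (rectpath a1 a3) \<subseteq> S - pts"
      using N \<tau> c by (subst path_image_rectpath) (auto simp: a_defs S_def dest: pts)
    have "F holomorphic_on (S - pts)" using hol by (simp add: S_def)
    then have contS: "continuous_on (S - pts) F"
      by (rule holomorphic_on_imp_continuous_on)
    have segs: "closed_segment a1 a2 \<subseteq> S - pts" "closed_segment a2 a3 \<subseteq> S - pts"
      "closed_segment a3 a4 \<subseteq> S - pts" "closed_segment a4 a1 \<subseteq> S - pts"
      using pim unfolding rp by (auto simp: path_image_join)
    note conts = segs[THEN continuous_on_subset[OF contS]]
    have ci: "F contour_integrable_on linepath a1 a2" "F contour_integrable_on linepath a2 a3"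
      "F contour_integrable_on linepath a3 a4" "F contour_integrable_on linepath a4 a1"
      using conts by (auto intro: contour_integrable_continuous_linepath)
    have "contour_integral (rectpath a1 a3) F
        = 2 * pi * \<i> * (\<Sum>p\<in>pts. winding_number (rectpath a1 a3) p * residue F p)"
    proof (rule Residue_theorem[OF \<open>open S\<close> _ fin])
      show "connected S" using \<open>convex S\<close> by (rule convex_connected)
      show "\<forall>z. z \<notin> S \<longrightarrow> winding_number (rectpath a1 a3) z = 0"
      proof (intro allI impI winding_number_rectpath_outside)
        fix z assume "z \<notin> S"
        then show "z \<notin> cbox a1 a3"
          using \<tau> c by (auto simp: S_def a_defs in_cbox_complex_iff)
      qed (use N \<tau> in \<open>auto simp: a_defs\<close>)
    qed (use pim hol in \<open>auto simp: S_def\<close>)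
    also have "(\<Sum>p\<in>pts. winding_number (rectpath a1 a3) p * residue F p) = (\<Sum>p\<in>pts. residue F p)"
    proof (rule sum.cong)
      fix p assume p: "p \<in> pts"
      have "winding_number (rectpath a1 a3) p = 1"
        by (rule winding_number_rectpath)
          (use N(3)[OF p] pts[OF p] in \<open>auto simp: a_defs in_box_complex_iff\<close>)
      then show "winding_number (rectpath a1 a3) p * residue F p = residue F p" by simp
    qed simp
    finally have res: "2 * of_real pi * \<i> * (\<Sum>p\<in>pts. residue F p)
      = contour_integral (linepath a1 a2) F + (contour_integral (linepath a2 a3) F
        + (contour_integral (linepath a3 a4) F + contour_integral (linepath a4 a1) F))"
      unfolding rp using ci by (simp add: contour_integrable_joinI)
    have vert: "contour_integral (linepath a2 a3) F = \<i> * integral {-\<tau>..\<tau>} (\<lambda>t. F (Complex c t))"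
      by (rule contour_integral_linepath_same_Re) (use \<tau> in \<open>auto simp: a_defs\<close>)
    have X: "X = contour_integral (linepath a1 a2) F - contour_integral (linepath a4 a3) F
        + contour_integral (linepath a4 a1) F"
      unfolding X_def res vert using contour_integral_reverse_linepath[of a4 a3 F] conts(3)
      by (simp add: closed_segment_commute)
    have b1: "norm (contour_integral (linepath a1 a2) F) \<le> M * q powr c / ln q"
      unfolding a1_def a2_def
    proof (rule contour_integral_horizontal_bound)
      show "continuous_on (closed_segment (Complex N (- \<tau>)) (Complex c (- \<tau>))) F"
        using conts(1) by (simp add: a_defs)
    qed (use hor[of "Complex _ (- \<tau>)"] \<tau> q N in auto)
    have b2: "norm (contour_integral (linepath a4 a3) F) \<le> M * q powr c / ln q"
      unfolding a4_def a3_def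
    proof (rule contour_integral_horizontal_bound)
      show "continuous_on (closed_segment (Complex N \<tau>) (Complex c \<tau>)) F"
        using conts(3) by (simp add: a_defs closed_segment_commute)
    qed (use hor[of "Complex _ \<tau>"] \<tau> q N in auto)
    have "norm (contour_integral (linepath a4 a1) F) \<le> (M' * q powr N) * norm (a1 - a4)"
    proof (rule contour_integral_bound_linepath[OF ci(4)])
      show "0 \<le> M' * q powr N"
        using left[of "Complex N 0"] N \<tau> norm_ge_zero[of "F (Complex N 0)"]
        by (simp del: norm_ge_zero)
      fix x assume "x \<in> closed_segment a4 a1"
      then have "Re x = N" "\<bar>Im x\<bar> \<le> \<tau>"
        using \<tau> by (auto simp: a_defs closed_segment_same_Re closed_segment_eq_real_ivl)
      then show "norm (F x) \<le> M' * q powr N" using left[of x] N by simp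
    qed
    also have "norm (a1 - a4) = 2 * \<tau>"
      using \<tau> by (simp add: a_defs cmod_def real_sqrt_mult)
    finally have b3: "norm (contour_integral (linepath a4 a1) F) \<le> 2 * \<tau> * M' * q powr N"
      by (simp add: mult_ac)
    show ?thesis
      unfolding X using b1 b2 b3
      by (smt (verit) norm_triangle_ineq norm_triangle_ineq4)
  qed
  have "norm X \<le> 2 * (M * q powr c / ln q) + 2 * \<tau> * M' * 0"
  proof (rule tendsto_lowerbound)
    have "((\<lambda>N. q powr N) \<longlongrightarrow> 0) at_bot" using q by (rule powr_tendsto_0_at_bot)
    then show "((\<lambda>N. 2 * (M * q powr c / ln q) + 2 * \<tau> * M' * q powr N)
        \<longlongrightarrow> 2 * (M * q powr c / ln q) + 2 * \<tau> * M' * 0) at_bot"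
      by (intro tendsto_intros)
    have "eventually (\<lambda>N. \<forall>p\<in>pts. N < Re p) at_bot"
      using fin by (auto simp: eventually_ball_finite_distrib)
    then show "eventually (\<lambda>N. norm X \<le> 2 * (M * q powr c / ln q) + 2 * \<tau> * M' * q powr N) at_bot"
      using eventually_gt_at_bot[of N1] eventually_gt_at_bot[of c]
      by eventually_elim (use ev in auto)
  qed simp
  then have "norm X / (2 * pi) \<le> 2 * (M * q powr c / ln q) / (2 * pi)"
    by (intro divide_right_mono) auto
  moreover have "(\<Sum>p\<in>pts. residue F p) - integral {-\<tau>..\<tau>} (\<lambda>t. F (Complex c t)) / (2 * pi)
      = X / (2 * pi * \<i>)"
    by (simp add: X_def field_simps)
  moreover have "norm (X / (2 * pi * \<i>)) = norm X / (2 * pi)"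
    by (simp add: norm_divide norm_mult)
  ultimately show ?thesis
    by (simp add: mult.commute)
qed

section \<open>Perron's integral\<close>

text \<open>With \<open>s = b + i t\<close> this is the integral of \<open>y powr s / s\<close> over
  the truncated line, divided by 2 pi i; the i cancels against ds. Negative \<open>b\<close> is
  meaningful too and is needed for the reflection below.\<close>

definition perron :: "real \<Rightarrow> real \<Rightarrow> real \<Rightarrow> complex" where
  "perron \<tau> y b = integral {-\<tau>..\<tau>} (\<lambda>t. of_real y powr Complex b t / Complex b t) / (2 * pi)"

lemma Complex_nonzero: "b \<noteq> 0 \<Longrightarrow> Complex b t \<noteq> 0"
  by (simp add: complex_eq_iff)

lemma continuous_on_Complex [continuous_intros]:
  "continuous_on S f \<Longrightarrow> continuous_on S (\<lambda>t. Complex b (f t))"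
  unfolding Complex_eq by (intro continuous_intros)

text \<open>Substituting \<open>-s\<close> for \<open>s\<close> trades \<open>y < 1\<close> for its
  inverse at the price of a negative abscissa. Thus the shift to the left, which needs a base above
  1, covers both ranges.\<close>

lemma perron_reflect:
  assumes "0 < y"
  shows "perron \<tau> y b = - perron \<tau> (inverse y) (-b)"
proof -
  have *: "of_real y powr Complex b (- t) / Complex b (- t)
      = - (of_real (inverse y) powr Complex (- b) t / Complex (- b) t)" for t
  proof -
    have "Complex b (- t) = - Complex (- b) t" by (simp add: complex_eq_iff)
    moreover have "complex_of_real y powr (- Complex (- b) t) = of_real (inverse y) powr Complex (- b) t"
      using assms by (simp add: powr_def Ln_inverse Ln_of_real flip: of_real_inverse)
        (simp add: ln_inverse)
    ultimately show ?thesis by simp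
  qed
  have "integral {-\<tau>..\<tau>} (\<lambda>t. of_real y powr Complex b t / Complex b t)
      = integral {-\<tau>..-(-\<tau>)} (\<lambda>t. of_real y powr Complex b (- t) / Complex b (- t))"
    by (rule Henstock_Kurzweil_Integration.integral_reflect_real[symmetric])
  then show ?thesis
    by (simp add: * perron_def)
qed

text \<open>The contour shift with \<open>q = y\<close>. The pole of 1/s at 0, of residue 1, is
  crossed just when \<open>b\<close> is positive, and on the horizontal edges 1/s has modulus at
  most 1/\<tau>.\<close>

lemma perron_error:
  assumes y: "1 < y" and b: "b \<noteq> 0" and \<tau>: "0 < \<tau>"
  shows "norm ((if 0 < b then 1 else 0) - perron \<tau> y b) \<le> y powr b / (pi * \<tau> * ln y)"
proof -
  define F where "F = (\<lambda>z. complex_of_real y powr z / z)"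
  define pts where "pts = (if 0 < b then {0::complex} else {})"
  \<comment> \<open>For negative \<open>b\<close> the region must stop before the pole at 0.\<close>
  define c' where "c' = (if 0 < b then b + 1 else 0)"
  have norm_F: "norm (F s) = y powr Re s / norm s" for s
    using y by (simp add: F_def norm_divide norm_powr_real_powr)
  have "norm ((\<Sum>p\<in>pts. residue F p) - integral {-\<tau>..\<tau>} (\<lambda>t. F (Complex b t)) / (2 * pi))
    \<le> (1 / \<tau>) * y powr b / (pi * ln y)"
  proof (rule contour_shift_left[where c' = c' and \<tau>' = "\<tau> + 1" and ?N1.0 = "-1" and M' = 1])
    show "F holomorphic_on ({s. Re s < c' \<and> \<bar>Im s\<bar> < \<tau> + 1} - pts)"
      unfolding F_def by (intro holomorphic_intros) (auto simp: pts_def c'_def split: if_splits)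
    fix s
    have *: "y powr Re s / norm s \<le> K * y powr Re s" if "1 / K \<le> norm s" "0 < K" for K
    proof -
      have "0 < norm s" using that by (meson less_le_trans zero_less_divide_1_iff)
      then have "1 \<le> K * norm s" using that by (simp add: field_simps)
      then show ?thesis
        using mult_right_mono[of 1 "K * norm s" "y powr Re s"] \<open>0 < norm s\<close>
        by (simp add: field_simps)
    qed
    { assume "\<bar>Im s\<bar> = \<tau>"
      then show "norm (F s) \<le> (1 / \<tau>) * y powr Re s"
        unfolding norm_F using \<tau> abs_Im_le_cmod[of s] by (intro *) auto }
    { assume "Re s \<le> -1"
      then show "norm (F s) \<le> 1 * y powr Re s"
        unfolding norm_F using abs_Re_le_cmod[of s] by (intro *) auto }
  qed (use y b \<tau> in \<open>auto simp: pts_def c'_def split: if_splits\<close>)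
  moreover have "residue F 0 = 1"
  proof -
    have "residue (\<lambda>w. (\<lambda>z. complex_of_real y powr z) w / (w - 0)) 0 = complex_of_real y powr 0"
      by (rule residue_simple[of UNIV]) (auto intro!: holomorphic_intros)
    then show ?thesis using y by (simp add: F_def)
  qed
  ultimately show ?thesis
    by (simp add: pts_def perron_def F_def mult_ac split: if_splits)
qed

text \<open>An antiderivative of 1/(b + it) has real part arctan(t/b) and an imaginary part that is
  even in t, which cancels over the symmetric interval.\<close>

lemma perron_one:
  assumes "0 < b" "0 \<le> \<tau>"
  shows "perron \<tau> 1 b = of_real (arctan (\<tau> / b) / pi)"
proof -
  have "((\<lambda>t. 1 / Complex b t) has_integral
      (Complex (arctan (\<tau> / b)) (- ln (b\<^sup>2 + \<tau>\<^sup>2) / 2)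
        - Complex (arctan (-\<tau> / b)) (- ln (b\<^sup>2 + (-\<tau>)\<^sup>2) / 2))) {-\<tau>..\<tau>}"
  proof (rule fundamental_theorem_of_calculus)
    fix t
    have pos: "0 < b\<^sup>2 + t\<^sup>2" using assms by (simp add: add_pos_nonneg)
    have 1: "((\<lambda>t. arctan (t / b)) has_real_derivative b / (b\<^sup>2 + t\<^sup>2)) (at t within {-\<tau>..\<tau>})"
      using assms pos by (auto intro!: derivative_eq_intros simp: field_simps power2_eq_square)
    have 2: "((\<lambda>t. - ln (b\<^sup>2 + t\<^sup>2) / 2) has_real_derivative - t / (b\<^sup>2 + t\<^sup>2)) (at t within {-\<tau>..\<tau>})"
      using assms pos by (auto intro!: derivative_eq_intros simp: field_simps)
    have "1 / Complex b t = Complex (b / (b\<^sup>2 + t\<^sup>2)) (- t / (b\<^sup>2 + t\<^sup>2))"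
      by (simp add: complex_eq_iff Re_divide Im_divide)
    then show "((\<lambda>t. Complex (arctan (t / b)) (- ln (b\<^sup>2 + t\<^sup>2) / 2)) has_vector_derivative 1 / Complex b t)
        (at t within {-\<tau>..\<tau>})"
      using 1 2 by (simp only:) (intro has_vector_derivative_complex_iff[THEN iffD2], simp add: has_real_derivative_iff_has_vector_derivative)
  qed (use assms in auto)
  then have "integral {-\<tau>..\<tau>} (\<lambda>t. 1 / Complex b t) = of_real (2 * arctan (\<tau> / b))"
    by (auto dest!: integral_unique simp: complex_eq_iff arctan_minus)
  then show ?thesis
    by (simp add: perron_def)
qed

text \<open>The source of all later majorants: uniform in \<tau>, which \<open>perron_error\<close>
  is not near \<open>y = 1\<close>. Where \<open>\<tau> * \<bar>ln y\<bar>\<close> is at least 1,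
  the error estimate suffices; otherwise \<open>y powr (i t)\<close> hardly oscillates over the
  interval and comparison with \<open>y = 1\<close> works.\<close>

lemma perron_bound:
  assumes y: "0 < y" and b: "0 < b" and \<tau>: "0 < \<tau>"
  shows "norm (perron \<tau> y b) \<le> 2 * y powr b"
proof -
  consider "1 \<le> ln y * \<tau>" | "ln y * \<tau> \<le> - 1" | "\<bar>ln y * \<tau>\<bar> \<le> 1" by linarith
  then show ?thesis
  proof cases
    case 1
    then have "0 < ln y" using \<tau> by (smt (verit) mult_nonpos_nonneg)
    then have y1: "1 < y" using y by simp
    have "norm (1 - perron \<tau> y b) \<le> y powr b / (pi * (\<tau> * ln y))"
      using perron_error[OF y1 _ \<tau>, of b] b by (simp add: mult.assoc)
    also have "\<dots> \<le> y powr b / (1 * 1)"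
      using pi_ge_two 1 by (intro divide_left_mono mult_mono) (auto simp: mult.commute)
    finally have "norm (perron \<tau> y b) \<le> 1 + y powr b"
      using norm_triangle_ineq2[of "perron \<tau> y b" 1] by (simp add: norm_minus_commute)
    then show ?thesis using ge_one_powr_ge_zero[of y b] y1 b by simp
  next
    case 2
    then have "ln y < 0" using \<tau> by (smt (verit) mult_nonneg_nonneg)
    then have y1: "1 < inverse y" using y by (simp add: one_less_inverse)
    have "norm (perron \<tau> y b) \<le> inverse y powr (- b) / (pi * (\<tau> * ln (inverse y)))"
      using perron_error[OF y1 _ \<tau>, of "-b"] b by (simp add: mult.assoc perron_reflect[OF y])
    also have "\<dots> \<le> inverse y powr (- b) / (1 * 1)"
    proof -
      have "1 \<le> \<tau> * ln (inverse y)" using 2 y by (simp add: ln_inverse mult.commute)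
      then show ?thesis using pi_ge_two by (intro divide_left_mono mult_mono) auto
    qed
    also have "\<dots> = y powr b" using y by (simp add: powr_minus powr_minus_divide inverse_powr)
    finally show ?thesis using powr_ge_zero[of y b] by linarith
  next
    case 3
    \<comment> \<open>Difference to the kernel at \<open>y = 1\<close> scaled by
      \<open>y powr b\<close>. The factor exp(i t ln y) - 1 supplies a \<open>t\<close> that absorbs
      the denominator, so the integral grows no faster than
      \<open>\<tau> * \<bar>ln y\<bar>\<close>.\<close>
    define f where "f t = (of_real y powr Complex b t - of_real (y powr b)) / Complex b t" for t
    have cont: "continuous_on {-\<tau>..\<tau>} (\<lambda>t. of_real y powr Complex b t / Complex b t)"
      "continuous_on {-\<tau>..\<tau>} (\<lambda>t. of_real (y powr b) * (1 / Complex b t))"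
      using y b by (auto intro!: continuous_intros Complex_nonzero simp: powr_def)
    have "integral {-\<tau>..\<tau>} f = integral {-\<tau>..\<tau>} (\<lambda>t. of_real y powr Complex b t / Complex b t)
        - integral {-\<tau>..\<tau>} (\<lambda>t. of_real (y powr b) * (1 / Complex b t))"
      using cont[THEN integrable_continuous_real]
      by (subst integral_diff[symmetric]) (auto simp: f_def diff_divide_distrib intro!: integral_cong)
    moreover have "integral {-\<tau>..\<tau>} (\<lambda>t. of_real (y powr b) * (1 / Complex b t))
        = of_real (y powr b) * integral {-\<tau>..\<tau>} (\<lambda>t. 1 / Complex b t)"
      by (rule integral_mult_right)
    ultimately have split: "perron \<tau> y b = integral {-\<tau>..\<tau>} f / (2 * pi) + of_real (y powr b) * perron \<tau> 1 b"
      by (simp add: perron_def add_divide_distrib[symmetric])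
    have f_bound: "norm (f t) \<le> y powr b * \<bar>ln y\<bar>" for t
    proof -
      have "of_real y powr Complex b t = of_real (y powr b) * exp (\<i> * of_real (t * ln y))"
      proof -
        have "Complex b t = of_real b + \<i> * of_real t" by (simp add: complex_eq_iff)
        then show ?thesis using y by (simp add: powr_def Ln_of_real exp_add ring_distribs mult_ac flip: exp_of_real)
      qed
      then have "f t = of_real (y powr b) * (exp (\<i> * of_real (t * ln y)) - 1) / Complex b t"
        by (simp add: f_def right_diff_distrib)
      moreover have "norm (exp (\<i> * of_real (t * ln y)) - 1) \<le> \<bar>t * ln y\<bar>"
        using abs_sin_x_le_abs_x[of "t * ln y / 2"] dist_exp_i_1[of "t * ln y"] by simp
      ultimately have "norm (f t) \<le> y powr b * \<bar>t * ln y\<bar> / norm (Complex b t)"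
        using y by (simp add: norm_mult norm_divide divide_right_mono mult_left_mono)
      also have "\<dots> = y powr b * \<bar>ln y\<bar> * (\<bar>t\<bar> / norm (Complex b t))"
        by (simp add: abs_mult)
      also have "\<dots> \<le> y powr b * \<bar>ln y\<bar> * 1"
        using abs_Im_le_cmod[of "Complex b t"] b
        by (intro mult_left_mono) (auto simp: divide_le_eq_1 complex_eq_iff)
      finally show ?thesis by simp
    qed
    have "norm (integral {-\<tau>..\<tau>} f) \<le> (y powr b * \<bar>ln y\<bar>) * (\<tau> - (-\<tau>))"
    proof (rule integral_bound)
      show "continuous_on {-\<tau>..\<tau>} f"
        unfolding f_def using y b by (auto intro!: continuous_intros Complex_nonzero simp: powr_def)
    qed (use \<tau> f_bound in auto)
    also have "\<dots> \<le> y powr b * 2"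
    proof -
      have "\<bar>ln y\<bar> * \<tau> \<le> 1" using 3 \<tau> by (simp add: abs_mult)
      then have "y powr b * (2 * (\<bar>ln y\<bar> * \<tau>)) \<le> y powr b * 2"
        by (intro mult_left_mono) auto
      then show ?thesis by (simp add: mult_ac)
    qed
    finally have "norm (integral {-\<tau>..\<tau>} f) / (2 * pi) \<le> y powr b * 2 / (2 * pi)"
      by (rule divide_right_mono) simp
    also have "\<dots> \<le> y powr b * 2 / (2 * 1)"
      using pi_ge_two by (intro divide_left_mono) auto
    finally have 1: "norm (integral {-\<tau>..\<tau>} f / (2 * pi)) \<le> y powr b"
      by (simp add: norm_divide norm_mult)
    have "arctan (\<tau> / b) \<le> pi" "0 \<le> arctan (\<tau> / b)"
      using arctan_ubound[of "\<tau> / b"] pi_gt_zero \<tau> b by linarith (use \<tau> b in simp)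
    then have "norm (perron \<tau> 1 b) \<le> 1"
      unfolding perron_one[OF b less_imp_le[OF \<tau>]] norm_of_real by (simp add: divide_le_eq_1)
    then have "norm (of_real (y powr b) * perron \<tau> 1 b) \<le> y powr b"
      by (simp add: norm_mult mult_left_le)
    then show ?thesis
      unfolding split using 1 norm_triangle_ineq[of "integral {-\<tau>..\<tau>} f / (2 * pi)"] by (smt (verit))
  qed
qed

lemma perron_tendsto:
  assumes y: "0 < y" and b: "0 < b"
  shows "((\<lambda>\<tau>. perron \<tau> y b) \<longlongrightarrow> (if 1 < y then 1 else if y = 1 then 1/2 else 0)) at_top"
proof -
  have lim: "((\<lambda>\<tau>. perron \<tau> z x) \<longlongrightarrow> (if 0 < x then 1 else 0)) at_top" if "1 < z" "x \<noteq> 0" for z x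
  proof (rule LIM_zero_cancel)
    show "((\<lambda>\<tau>. perron \<tau> z x - (if 0 < x then 1 else 0)) \<longlongrightarrow> 0) at_top"
    proof (rule Lim_null_comparison)
      show "eventually (\<lambda>\<tau>. norm (perron \<tau> z x - (if 0 < x then 1 else 0))
          \<le> z powr x / (pi * ln z) / \<tau>) at_top"
        using eventually_gt_at_top[of 0]
        by eventually_elim (use perron_error[OF that] in \<open>simp add: norm_minus_commute mult_ac\<close>)
      show "((\<lambda>\<tau>. z powr x / (pi * ln z) / \<tau>) \<longlongrightarrow> 0) at_top"
        by (rule tendsto_divide_0[OF tendsto_const]) (simp add: filterlim_at_top_imp_at_infinity filterlim_ident)
    qed
  qed
  consider "1 < y" | "y = 1" | "y < 1" by linarith
  then show ?thesis
  proof cases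
    case 1
    then show ?thesis using lim[of y b] b by simp
  next
    case 2
    have "((\<lambda>\<tau>. arctan (\<tau> / b) / pi) \<longlongrightarrow> pi / 2 / pi) at_top"
      by (intro tendsto_intros filterlim_compose[OF tendsto_arctan_at_top])
        (use b in \<open>auto simp: filterlim_ident divide_inverse intro!: filterlim_at_top_mult_tendsto_pos[OF tendsto_const]\<close>)
    then have "((\<lambda>\<tau>. complex_of_real (arctan (\<tau> / b) / pi)) \<longlongrightarrow> of_real (1/2)) at_top"
      by (intro tendsto_of_real) simp
    moreover have "eventually (\<lambda>\<tau>. complex_of_real (arctan (\<tau> / b) / pi) = perron \<tau> y b) at_top"
      using eventually_ge_at_top[of 0] by eventually_elim (simp add: 2 perron_one[OF b])
    ultimately show ?thesis using 2 by (simp add: tendsto_cong)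
  next
    case 3
    have "((\<lambda>\<tau>. - perron \<tau> (inverse y) (- b)) \<longlongrightarrow> - 0) at_top"
      by (intro tendsto_minus) (use lim[of "inverse y" "-b"] 3 y b in \<open>simp add: one_less_inverse\<close>)
    then show ?thesis using 3 by (simp add: perron_reflect[OF y, symmetric])
  qed
qed

section \<open>Zeros of Dirichlet polynomials\<close>

text \<open>Far to the left the smallest ratio \<rho> dominates. The indices attaining it contribute
  \<open>card I\<close> equal terms, which cannot cancel each other; after division by
  \<open>\<rho> powr x\<close> the remaining terms and the constant 1 tend to 0.\<close>

lemma dirichlet_polynomial_lower_bound_left:
  fixes r :: "nat \<Rightarrow> real"
  assumes r: "\<And>j. j \<in> {1..J} \<Longrightarrow> 0 < r j \<and> r j < 1" and J: "1 \<le> J"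
  obtains a where "\<And>s. Re s \<le> a \<Longrightarrow> 1/2 \<le> norm (1 - (\<Sum>j=1..J. complex_of_real (r j) powr s))"
proof -
  define \<rho> where "\<rho> = Min (r ` {1..J})"
  define I where "I = {j \<in> {1..J}. r j = \<rho>}"
  define K where "K = {j \<in> {1..J}. r j \<noteq> \<rho>}"
  have "\<rho> \<in> r ` {1..J}" unfolding \<rho>_def using J by (intro Min_in) auto
  then obtain j0 where j0: "j0 \<in> {1..J}" "r j0 = \<rho>" by auto
  have \<rho>: "0 < \<rho>" "\<rho> < 1" using r[OF j0(1)] j0(2) by auto
  have le: "\<rho> \<le> r j" if "j \<in> {1..J}" for j using that by (auto simp: \<rho>_def)
  have part: "{1..J} = I \<union> K" "I \<inter> K = {}" and fin: "finite I" "finite K"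
    by (auto simp: I_def K_def)
  have "card I \<noteq> 0" using fin j0 by (auto simp: I_def)
  then have card: "1 \<le> real (card I)" by simp
  have "((\<lambda>x. real (card I) - (\<Sum>j\<in>K. (r j / \<rho>) powr x) - (1 / \<rho>) powr x)
      \<longlongrightarrow> real (card I) - (\<Sum>j\<in>K. 0) - 0) at_bot"
  proof (intro tendsto_intros powr_tendsto_0_at_bot)
    fix j assume "j \<in> K"
    then show "1 < r j / \<rho>" using \<rho> le[of j] by (auto simp: K_def)
  qed (use \<rho> in auto)
  then have "eventually (\<lambda>x. 1/2 < real (card I) - (\<Sum>j\<in>K. (r j / \<rho>) powr x) - (1 / \<rho>) powr x) at_bot"
    by (rule order_tendstoD) (use card in auto)
  then obtain a where a: "\<And>x. x \<le> a \<Longrightarrow>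
      1/2 < real (card I) - (\<Sum>j\<in>K. (r j / \<rho>) powr x) - (1 / \<rho>) powr x"
    by (auto simp: eventually_at_bot_linorder)
  show thesis
  \<comment> \<open>A nonpositive real part gives \<open>1 \<le> \<rho> powr x\<close>, so undoing
    the division keeps the bound 1/2.\<close>
  proof (rule that[of "min a 0"])
    fix s :: complex assume s: "Re s \<le> min a 0"
    define x where "x = Re s"
    have x: "x \<le> a" "x \<le> 0" using s by (auto simp: x_def)
    have "1 \<le> \<rho> powr x"
      using powr_mono'[of x 0 \<rho>] \<rho> x by simp
    have "(\<Sum>j=1..J. complex_of_real (r j) powr s)
        = of_nat (card I) * of_real \<rho> powr s + (\<Sum>j\<in>K. complex_of_real (r j) powr s)"
      unfolding part(1) using fin part(2) by (subst sum.union_disjoint) (auto simp: I_def)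
    then have eq: "1 - (\<Sum>j=1..J. complex_of_real (r j) powr s)
        = - (of_nat (card I) * of_real \<rho> powr s - (1 - (\<Sum>j\<in>K. complex_of_real (r j) powr s)))"
      by simp
    have "norm (\<Sum>j\<in>K. complex_of_real (r j) powr s) \<le> (\<Sum>j\<in>K. r j powr x)"
      by (rule sum_norm_le) (use r in \<open>auto simp: K_def norm_powr_real_powr less_imp_le x_def\<close>)
    then have "norm (1 - (\<Sum>j\<in>K. complex_of_real (r j) powr s)) \<le> 1 + (\<Sum>j\<in>K. r j powr x)"
      using norm_triangle_ineq4[of 1 "\<Sum>j\<in>K. complex_of_real (r j) powr s"] by simp
    moreover have "norm (of_nat (card I) * complex_of_real \<rho> powr s) = real (card I) * \<rho> powr x"
      using \<rho> by (simp add: norm_mult norm_powr_real_powr x_def)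
    ultimately have "real (card I) * \<rho> powr x - (1 + (\<Sum>j\<in>K. r j powr x))
        \<le> norm (1 - (\<Sum>j=1..J. complex_of_real (r j) powr s))"
      unfolding eq norm_minus_cancel
      using norm_triangle_ineq2[of "of_nat (card I) * complex_of_real \<rho> powr s"
          "1 - (\<Sum>j\<in>K. complex_of_real (r j) powr s)"] by linarith
    moreover have "real (card I) * \<rho> powr x - (1 + (\<Sum>j\<in>K. r j powr x))
        = \<rho> powr x * (real (card I) - (\<Sum>j\<in>K. (r j / \<rho>) powr x) - (1 / \<rho>) powr x)"
    proof -
      have "(\<Sum>j\<in>K. r j powr x) = \<rho> powr x * (\<Sum>j\<in>K. (r j / \<rho>) powr x)"
        unfolding sum_distrib_left
        by (rule sum.cong) (use \<rho> r in \<open>auto simp: K_def powr_divide less_imp_le\<close>)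
      moreover have "\<rho> powr x * (1 / \<rho>) powr x = 1"
        using \<rho> by (simp add: powr_divide)
      ultimately show ?thesis by (simp add: algebra_simps)
    qed
    moreover have "1 * (1/2) \<le> \<rho> powr x * (real (card I) - (\<Sum>j\<in>K. (r j / \<rho>) powr x) - (1 / \<rho>) powr x)"
      by (rule mult_mono) (use \<open>1 \<le> \<rho> powr x\<close> a[OF x(1)] in auto)
    ultimately show "1/2 \<le> norm (1 - (\<Sum>j=1..J. complex_of_real (r j) powr s))"
      by linarith
  qed
qed

text \<open>If no uniform \<open>\<delta>\<close> existed, some limit \<open>1 - \<Sum>\<^sub>j l\<^sub>j r\<^sub>j\<^sup>s\<close> of vertical translates would vanish somewhere on each
  horizontal segment, and so would have infinitely many zeros in a compact rectangle.\<close>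

lemma dirichlet_polynomial_horizontal_lines:
  fixes r :: "nat \<Rightarrow> real"
  assumes r: "\<And>j. j \<in> {1..J} \<Longrightarrow> 0 < r j \<and> r j < 1"
    and c: "(\<Sum>j=1..J. r j powr c) < 1" and ac: "a \<le> c"
  obtains \<delta> \<tau> where "0 < \<delta>" "\<And>n. real n \<le> \<tau> n \<and> \<tau> n \<le> real n + 1"
    "\<And>n s. a \<le> Re s \<Longrightarrow> Re s \<le> c \<Longrightarrow> \<bar>Im s\<bar> = \<tau> n \<Longrightarrow>
      \<delta> \<le> norm (1 - (\<Sum>j=1..J. complex_of_real (r j) powr s))"
proof -
  define f where "f s = 1 - (\<Sum>j=1..J. complex_of_real (r j) powr s)" for s
  have "\<exists>\<delta>>0. \<forall>n::nat. \<exists>t\<in>{real n..real n + 1}. \<forall>s. a \<le> Re s \<and> Re s \<le> c \<and> Im s = t \<longrightarrow> \<delta> \<le> norm (f s)"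
  proof (rule ccontr)
    assume neg: "\<not> ?thesis"
    have "\<exists>n::nat. \<forall>t\<in>{real n..real n + 1}. \<exists>s. a \<le> Re s \<and> Re s \<le> c \<and> Im s = t
        \<and> norm (f s) < inverse (real (Suc k))" for k
      using neg inverse_positive_iff_positive[of "real (Suc k)"] unfolding not_less[symmetric] by fastforce
    then obtain N :: "nat \<Rightarrow> nat" where N: "\<And>k t. t \<in> {real (N k)..real (N k) + 1} \<Longrightarrow>
        \<exists>s. a \<le> Re s \<and> Re s \<le> c \<and> Im s = t \<and> norm (f s) < inverse (real (Suc k))"
      by metis
    \<comment> \<open>Translating upwards by \<open>N k\<close> multiplies the j-th term by
      \<open>\<theta> k j\<close>. These multipliers are bounded and finitely many for each k, so a
      subsequence converges and yields the limit function \<open>g\<close>.\<close>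
    define \<theta> where "\<theta> k j = complex_of_real (r j) powr (\<i> * of_nat (N k))" for k j
    have norm_\<theta>: "norm (\<theta> k j) \<le> 1" if "j \<in> {1..J}" for k j
      using r[OF that] by (simp add: \<theta>_def norm_powr_real_powr)
    obtain \<phi> :: "nat \<Rightarrow> nat" where \<phi>: "strict_mono \<phi>"
      and conv: "\<And>j. j \<in> {1..J} \<Longrightarrow> \<exists>l. (\<lambda>k. \<theta> (\<phi> k) j) \<longlonglongrightarrow> l"
      using function_convergent_subsequence[of "{1..J}" \<theta> 1] norm_\<theta> by (metis countable_finite finite_atLeastAtMost)
    from conv obtain l where l: "\<And>j. j \<in> {1..J} \<Longrightarrow> (\<lambda>k. \<theta> (\<phi> k) j) \<longlonglongrightarrow> l j"
      by metis
    have norm_l: "norm (l j) \<le> 1" if "j \<in> {1..J}" for j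
      by (rule Lim_norm_ubound[OF _ l[OF that]]) (use norm_\<theta>[OF that] in auto)
    define g where "g s = 1 - (\<Sum>j=1..J. l j * complex_of_real (r j) powr s)" for s
    have hol: "g holomorphic_on UNIV"
      unfolding g_def by (intro holomorphic_intros)
    \<comment> \<open>At the real point \<open>c\<close> the multipliers cannot enlarge the terms,
      whose sum is below 1 there. Hence \<open>g\<close> is not identically zero and has finitely
      many zeros in \<open>K\<close>.\<close>
    have "norm (\<Sum>j=1..J. l j * complex_of_real (r j) powr c) \<le> (\<Sum>j=1..J. r j powr c)"
    proof (rule sum_norm_le)
      fix j assume j: "j \<in> {1..J}"
      show "norm (l j * complex_of_real (r j) powr c) \<le> r j powr c"
        using norm_l[OF j] r[OF j] by (simp add: norm_mult norm_powr_real_powr mult_left_le_one_le)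
    qed
    then have gc: "g c \<noteq> 0"
      using c by (auto simp: g_def)
    define K where "K = cbox (Complex a 0) (Complex c 1)"
    have "finite {z\<in>K. g z = 0}"
    proof (cases "g constant_on UNIV")
      case True
      then have "g z \<noteq> 0" for z using gc by (metis constant_on_def UNIV_I)
      then show ?thesis by simp
    next
      case False
      then show ?thesis
        by (intro holomorphic_compact_finite_zeros[OF hol]) (auto simp: K_def)
    qed
    then have "infinite ({0..1} - Im ` {z\<in>K. g z = 0})"
      by (intro Diff_infinite_finite finite_imageI) (auto simp: infinite_Icc)
    then obtain t where t: "t \<in> {0..1}" "t \<notin> Im ` {z\<in>K. g z = 0}"
      using infinite_imp_nonempty by blast
    define L where "L = closed_segment (Complex a t) (Complex c t)"
    have L: "s \<in> L \<longleftrightarrow> a \<le> Re s \<and> Re s \<le> c \<and> Im s = t" for s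
      using ac by (auto simp: L_def closed_segment_same_Im closed_segment_eq_real_ivl)
    have "L \<noteq> {}" "compact L" by (auto simp: L_def)
    moreover have "continuous_on L (\<lambda>s. norm (g s))"
      using holomorphic_on_imp_continuous_on[OF hol] by (intro continuous_intros) (auto intro: continuous_on_subset)
    ultimately obtain s0 where s0: "s0 \<in> L" "\<And>s. s \<in> L \<Longrightarrow> norm (g s0) \<le> norm (g s)"
      using continuous_attains_inf[of L "\<lambda>s. norm (g s)"] by blast
    define m where "m = norm (g s0)"
    have "s0 \<in> K" using s0(1) t unfolding L by (auto simp: K_def in_cbox_complex_iff)
    then have "m > 0" using t s0(1) unfolding L by (auto simp: m_def)
    \<comment> \<open>On \<open>L\<close> the modulus of the j-th power is at most
      \<open>r j powr a\<close>, so convergence of the multipliers makes the translates converge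
      uniformly on \<open>L\<close>, where \<open>g\<close> has modulus at least
      \<open>m\<close>.\<close>
    have "(\<lambda>k. \<Sum>j=1..J. norm (\<theta> (\<phi> k) j - l j) * r j powr a) \<longlonglongrightarrow> (\<Sum>j=1..J. 0 * r j powr a)"
      by (intro tendsto_intros tendsto_norm_zero LIM_zero l) auto
    then have "(\<lambda>k. \<Sum>j=1..J. norm (\<theta> (\<phi> k) j - l j) * r j powr a) \<longlonglongrightarrow> 0"
      by simp
    then have "eventually (\<lambda>k. (\<Sum>j=1..J. norm (\<theta> (\<phi> k) j - l j) * r j powr a) < m / 2) sequentially"
      by (rule order_tendstoD) (use \<open>m > 0\<close> in auto)
    moreover have "eventually (\<lambda>k. inverse (real (Suc (\<phi> k))) < m / 2) sequentially"
    proof -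
      have "(\<lambda>k. inverse (real (Suc (\<phi> k)))) \<longlonglongrightarrow> 0"
        using LIMSEQ_subseq_LIMSEQ[OF LIMSEQ_inverse_real_of_nat \<phi>] by (simp add: o_def)
      then show ?thesis by (rule order_tendstoD) (use \<open>m > 0\<close> in auto)
    qed
    ultimately have "eventually (\<lambda>k. (\<Sum>j=1..J. norm (\<theta> (\<phi> k) j - l j) * r j powr a) < m / 2
        \<and> inverse (real (Suc (\<phi> k))) < m / 2) sequentially"
      by eventually_elim auto
    then obtain k where k: "(\<Sum>j=1..J. norm (\<theta> (\<phi> k) j - l j) * r j powr a) < m / 2"
      "inverse (real (Suc (\<phi> k))) < m / 2"
      by (auto simp: eventually_sequentially)
    obtain s where s: "a \<le> Re s" "Re s \<le> c" "Im s = t + real (N (\<phi> k))"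
      "norm (f s) < inverse (real (Suc (\<phi> k)))"
      using N[of "t + real (N (\<phi> k))" "\<phi> k"] t by auto
    define s' where "s' = s - \<i> * of_nat (N (\<phi> k))"
    have "s' \<in> L" using s by (simp add: L s'_def)
    have "f s - g s' = - (\<Sum>j=1..J. (\<theta> (\<phi> k) j - l j) * complex_of_real (r j) powr s')"
    proof -
      have "s = \<i> * of_nat (N (\<phi> k)) + s'" by (simp add: s'_def)
      then have "complex_of_real (r j) powr s = \<theta> (\<phi> k) j * complex_of_real (r j) powr s'" for j
        unfolding \<theta>_def by (metis powr_add)
      then show ?thesis
        by (simp add: f_def g_def sum_subtractf left_diff_distrib)
    qed
    also have "norm \<dots> \<le> (\<Sum>j=1..J. norm (\<theta> (\<phi> k) j - l j) * r j powr a)"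
      unfolding norm_minus_cancel
    proof (rule sum_norm_le)
      fix j assume j: "j \<in> {1..J}"
      have "norm (complex_of_real (r j) powr s') = r j powr Re s'"
        using r[OF j] by (simp add: norm_powr_real_powr)
      also have "\<dots> \<le> r j powr a"
        using r[OF j] \<open>s' \<in> L\<close> by (intro powr_mono') (auto simp: L)
      finally show "norm ((\<theta> (\<phi> k) j - l j) * complex_of_real (r j) powr s')
          \<le> norm (\<theta> (\<phi> k) j - l j) * r j powr a"
        by (simp add: norm_mult mult_left_mono)
    qed
    finally have "norm (f s - g s') < m / 2" using k by linarith
    moreover have "m \<le> norm (g s')" using s0(2)[OF \<open>s' \<in> L\<close>] by (simp add: m_def)
    ultimately show False
      using s(4) k(2) norm_triangle_ineq2[of "g s'" "f s"] by (simp add: norm_minus_commute)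
  qed
  then obtain \<delta> where \<delta>: "0 < \<delta>" and ex: "\<forall>n::nat. \<exists>t. t\<in>{real n..real n + 1} \<and>
      (\<forall>s. a \<le> Re s \<and> Re s \<le> c \<and> Im s = t \<longrightarrow> \<delta> \<le> norm (f s))"
    unfolding Bex_def by blast
  from choice[OF ex] obtain \<tau> where \<tau>: "\<And>n. \<tau> n \<in> {real n..real n + 1}"
    "\<And>n s. a \<le> Re s \<and> Re s \<le> c \<and> Im s = \<tau> n \<Longrightarrow> \<delta> \<le> norm (f s)"
    by auto
  show thesis
  proof (rule that[OF \<delta>, of \<tau>])
    show "real n \<le> \<tau> n \<and> \<tau> n \<le> real n + 1" for n using \<tau>(1)[of n] by simp
    fix n s assume s: "a \<le> Re s" "Re s \<le> c" "\<bar>Im s\<bar> = \<tau> n"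
    \<comment> \<open>The lines were found in the upper half plane; conjugation symmetry, valid for
      positive ratios, carries the bound to their mirror images.\<close>
    have "f (cnj s) = cnj (f s)"
    proof -
      have "of_real (r j) powr cnj s = cnj (of_real (r j) powr s)" if "j \<in> {1..J}" for j
        using r[OF that] cnj_powr[of "of_real (r j)" s] by simp
      then show ?thesis by (simp add: f_def)
    qed
    then have "norm (f (cnj s)) = norm (f s)" by simp
    moreover have "\<delta> \<le> norm (f s) \<or> \<delta> \<le> norm (f (cnj s))"
      using s \<tau>(2)[of s n] \<tau>(2)[of "cnj s" n] by (auto simp: abs_if split: if_splits)
    ultimately show "\<delta> \<le> norm (1 - (\<Sum>j=1..J. complex_of_real (r j) powr s))"
      by (auto simp: f_def)
  qed
qed

section \<open>Inner neighbourhoods and similitudes\<close>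

text \<open>Subtracting \<open>f 0\<close> and dividing by \<open>r\<close> leaves an isometry
  fixing the origin, which is an orthogonal transformation and hence bijective.\<close>

lemma similitude_bij:
  fixes f :: "'a::euclidean_space \<Rightarrow> 'a"
  assumes f: "similitude r f" and r: "0 < r"
  shows "bij f"
proof -
  define T where "T x = (1 / r) *\<^sub>R (f x - f 0)" for x
  have "dist (T x) (T y) = dist x y" for x y
  proof -
    have "dist (T x) (T y) = norm ((1 / r) *\<^sub>R (f x - f y))"
      by (simp add: T_def dist_norm flip: scaleR_diff_right)
    also have "\<dots> = dist (f x) (f y) / r"
      using r by (simp add: dist_norm)
    finally show ?thesis
      using f r by (simp add: similitude_def)
  qed
  then have "orthogonal_transformation T"
    unfolding orthogonal_transformation_isometry by (simp add: T_def)
  then have "bij T" by (rule orthogonal_transformation_bij)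
  moreover have "bij (\<lambda>x. r *\<^sub>R x + f 0)"
    by (rule bij_betw_byWitness[where f' = "\<lambda>y. (1 / r) *\<^sub>R (y - f 0)"]) (use r in auto)
  ultimately have "bij ((\<lambda>x. r *\<^sub>R x + f 0) \<circ> T)" by (rule bij_comp)
  moreover have "(\<lambda>x. r *\<^sub>R x + f 0) \<circ> T = f"
    using r by (auto simp: T_def)
  ultimately show ?thesis by simp
qed

lemma similitude_inv:
  fixes f :: "'a::euclidean_space \<Rightarrow> 'a"
  assumes f: "similitude r f" and r: "0 < r"
  shows "similitude (1 / r) (inv f)"
  unfolding similitude_def
proof (intro allI)
  fix x y
  have surj: "f (inv f z) = z" for z
    using similitude_bij[OF assms] by (simp add: bij_is_surj surj_f_inv_f)
  have "dist x y = r * dist (inv f x) (inv f y)"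
    using f[unfolded similitude_def, rule_format, of "inv f x" "inv f y"] by (simp add: surj)
  then show "dist (inv f x) (inv f y) = 1 / r * dist x y" using r by simp
qed

lemma similitude_continuous_on:
  assumes "similitude r f" "0 < r"
  shows "continuous_on S f"
proof (rule continuous_onI)
  fix x e assume "0 < (e::real)"
  then show "\<exists>d>0. \<forall>x'\<in>S. dist x' x < d \<longrightarrow> dist (f x') (f x) \<le> e"
    using assms by (intro exI[of _ "e / r"]) (auto simp: similitude_def field_simps)
qed

lemma similitude_open_image:
  fixes f :: "'a::euclidean_space \<Rightarrow> 'a"
  assumes "similitude r f" "0 < r" "open U"
  shows "open (f ` U)"
proof -
  have "f ` U = inv f -` U"
    using similitude_bij[OF assms(1,2)] by (simp add: bij_vimage_eq_inv_image bij_imp_bij_inv inv_inv_eq)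
  then show ?thesis
    using similitude_continuous_on[OF similitude_inv[OF assms(1,2)]] assms
    by (simp add: open_vimage)
qed

lemma similitude_bounded_image:
  assumes "similitude r f" "bounded U"
  shows "bounded (f ` U)"
proof -
  obtain x e where "\<forall>y\<in>U. dist x y \<le> e" using assms(2) by (auto simp: bounded_def)
  then have "\<forall>y\<in>U. dist (f x) (f y) \<le> \<bar>r\<bar> * e"
    using assms(1) by (auto simp: similitude_def intro!: mult_mono)
  then show ?thesis by (auto simp: bounded_def)
qed

lemma similitude_image_ball:
  fixes f :: "'a::euclidean_space \<Rightarrow> 'a"
  assumes f: "similitude r f" and r: "0 < r"
  shows "f ` ball x \<rho> = ball (f x) (r * \<rho>)" "f ` cball x \<rho> = cball (f x) (r * \<rho>)"
proof -
  have "y \<in> f ` ball x \<rho> \<longleftrightarrow> y \<in> ball (f x) (r * \<rho>)" "y \<in> f ` cball x \<rho> \<longleftrightarrow> y \<in> cball (f x) (r * \<rho>)" for y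
  proof -
    obtain z where z: "y = f z" using similitude_bij[OF assms] by (metis bij_pointE)
    have "f z \<in> f ` S \<longleftrightarrow> z \<in> S" for S
      using similitude_bij[OF assms] by (simp add: bij_is_inj inj_image_mem_iff)
    then show "y \<in> f ` ball x \<rho> \<longleftrightarrow> y \<in> ball (f x) (r * \<rho>)" "y \<in> f ` cball x \<rho> \<longleftrightarrow> y \<in> cball (f x) (r * \<rho>)"
      using f r by (simp_all add: z similitude_def)
  qed
  then show "f ` ball x \<rho> = ball (f x) (r * \<rho>)" "f ` cball x \<rho> = cball (f x) (r * \<rho>)" by blast+
qed

text \<open>By Vitali an open set is, up to a null set, a disjoint union of balls, and similitudes map balls
  to balls.\<close>

lemma emeasure_similitude_ge:
  fixes f :: "'a::euclidean_space \<Rightarrow> 'a"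
  assumes f: "similitude r f" and r: "0 < r" and U: "open U"
  shows "ennreal (r ^ DIM('a)) * emeasure lborel U \<le> emeasure lborel (f ` U)"
proof -
  define K where "K = {p :: 'a \<times> real. 0 < snd p \<and> ball (fst p) (snd p) \<subseteq> U}"
  have "\<exists>i. i \<in> K \<and> x \<in> ball (fst i) (snd i) \<and> snd i < d" if x: "x \<in> U" "0 < d" for x d
  proof -
    obtain e where "0 < e" "ball x e \<subseteq> U" using openE[OF U x(1)] .
    then show ?thesis
      using x by (intro exI[of _ "(x, min e (d / 2))"]) (auto simp: K_def)
  qed
  from Vitali_covering_theorem_balls[of U K fst snd, OF this]
  obtain C where C: "countable C" "C \<subseteq> K"
    "pairwise (\<lambda>i j. disjnt (ball (fst i) (snd i)) (ball (fst j) (snd j))) C"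
    "negligible (U - (\<Union>i \<in> C. ball (fst i) (snd i)))"
    by blast
  let ?B = "\<lambda>i. ball (fst i) (snd i)"
  have disj: "disjoint_family_on ?B C"
    using C(3) by (auto simp: disjoint_family_on_def pairwise_def disjnt_def)
  have inj: "inj f" using similitude_bij[OF f r] by (rule bij_is_inj)
  have disj': "disjoint_family_on (\<lambda>i. f ` ?B i) C"
    using disj image_Int[OF inj] unfolding disjoint_family_on_def by (metis image_empty)
  have "emeasure lborel U = emeasure lborel ((\<Union>i\<in>C. ?B i) \<union> (U - (\<Union>i\<in>C. ?B i)))"
    using C(2) by (intro arg_cong[of _ _ "emeasure lborel"]) (auto simp: K_def)
  also have "\<dots> = emeasure lborel (\<Union>i\<in>C. ?B i)"
  proof (rule emeasure_Un_null_set)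
    have "U - (\<Union>i\<in>C. ?B i) \<in> sets borel"
      using U by (intro sets.Diff borel_open open_UN) auto
    then show "U - (\<Union>i\<in>C. ?B i) \<in> null_sets lborel"
      using C(4) by (auto simp: negligible_iff_null_sets null_sets_completion_iff)
  qed (auto intro!: borel_open open_UN)
  also have "\<dots> = (\<integral>\<^sup>+i. emeasure lborel (?B i) \<partial>count_space C)"
    using C(1) disj by (intro emeasure_UN_countable) auto
  finally have "ennreal (r ^ DIM('a)) * emeasure lborel U
      = (\<integral>\<^sup>+i. ennreal (r ^ DIM('a)) * emeasure lborel (?B i) \<partial>count_space C)"
    by (simp add: nn_integral_cmult)
  also have "\<dots> = (\<integral>\<^sup>+i. emeasure lborel (f ` ?B i) \<partial>count_space C)"
  proof (intro nn_integral_cong)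
    fix i assume "i \<in> space (count_space C)"
    then have "0 < snd i" using C(2) by (auto simp: K_def)
    then show "ennreal (r ^ DIM('a)) * emeasure lborel (?B i) = emeasure lborel (f ` ?B i)"
      using r by (simp add: similitude_image_ball[OF f r] emeasure_ball power_mult_distrib
          mult_ac flip: ennreal_mult)
  qed
  also have "\<dots> = emeasure lborel (\<Union>i\<in>C. f ` ?B i)"
    using C(1) disj' by (intro emeasure_UN_countable[symmetric]) (auto simp: similitude_image_ball[OF f r])
  \<comment> \<open>Just an inequality: the image of the null set that the balls leave over is not
    controlled at this point.\<close>
  also have "\<dots> \<le> emeasure lborel (f ` U)"
    using C(2) similitude_open_image[OF f r U] by (intro emeasure_mono) (auto simp: K_def)
  finally show ?thesis .
qed

text \<open>The reverse inequality is the same lower bound for the inverse similitude, of ratio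
  \<open>1 / r\<close>, applied to the image.\<close>

lemma measure_similitude_open:
  fixes f :: "'a::euclidean_space \<Rightarrow> 'a"
  assumes f: "similitude r f" and r: "0 < r" and U: "open U"
  shows "measure lebesgue (f ` U) = r ^ DIM('a) * measure lebesgue U"
proof -
  note fU = similitude_open_image[OF assms]
  have inv: "inv f ` f ` U = U"
    using similitude_bij[OF f r] by (simp add: bij_is_inj image_inv_f_f)
  have "ennreal ((1 / r) ^ DIM('a)) * emeasure lborel (f ` U) \<le> emeasure lborel U"
    using emeasure_similitude_ge[OF similitude_inv[OF f r] _ fU] r by (simp add: inv)
  then have "ennreal (r ^ DIM('a)) * (ennreal ((1 / r) ^ DIM('a)) * emeasure lborel (f ` U))
      \<le> ennreal (r ^ DIM('a)) * emeasure lborel U"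
    by (rule mult_left_mono) simp
  also have "ennreal (r ^ DIM('a)) * (ennreal ((1 / r) ^ DIM('a)) * emeasure lborel (f ` U))
      = emeasure lborel (f ` U)"
    using r by (simp add: mult.assoc[symmetric] power_one_over flip: ennreal_mult)
  finally have "emeasure lborel (f ` U) = ennreal (r ^ DIM('a)) * emeasure lborel U"
    using emeasure_similitude_ge[OF assms] by (rule antisym)
  then have "measure lborel (f ` U) = r ^ DIM('a) * measure lborel U"
    using r by (simp add: measure_def enn2real_mult)
  then show ?thesis
    using U fU by (simp add: measure_completion)
qed

section \<open>Inner neighbourhoods described by closed balls\<close>

lemma frontier_bounded_nonempty:
  fixes U :: "'a::euclidean_space set"
  shows "bounded U \<Longrightarrow> U \<noteq> {} \<Longrightarrow> frontier U \<noteq> {}"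
  by (metis frontier_not_empty not_bounded_UNIV)

text \<open>Closed balls are easier to carry through similitudes and disjoint unions than frontiers.
  A nearest frontier point lies outside the open set \<open>U\<close>; conversely a ball meeting
  \<open>U\<close> and its complement is connected and so meets the frontier.\<close>

lemma infdist_frontier_le_iff:
  fixes U :: "'a::euclidean_space set"
  assumes U: "open U" "bounded U" and x: "x \<in> U" and e: "0 \<le> \<epsilon>"
  shows "infdist x (frontier U) \<le> \<epsilon> \<longleftrightarrow> \<not> cball x \<epsilon> \<subseteq> U"
proof
  assume le: "infdist x (frontier U) \<le> \<epsilon>"
  obtain y where y: "y \<in> frontier U" "infdist x (frontier U) = dist x y"
    using infdist_attains_inf[of "frontier U" x] frontier_bounded_nonempty[of U] U x by auto
  then have "y \<in> cball x \<epsilon>" "y \<notin> U"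
    using le U(1) by (auto simp: frontier_def interior_open)
  then show "\<not> cball x \<epsilon> \<subseteq> U" by auto
next
  assume not: "\<not> cball x \<epsilon> \<subseteq> U"
  have "x \<in> cball x \<epsilon> \<inter> U" using x e by simp
  then have "cball x \<epsilon> \<inter> frontier U \<noteq> {}"
    using not by (intro connected_Int_frontier convex_connected) blast+
  then obtain y where "y \<in> frontier U" "dist x y \<le> \<epsilon>" by auto
  then show "infdist x (frontier U) \<le> \<epsilon>" using infdist_le2 by metis
qed

lemma inner_neighbourhood_sets:
  fixes U :: "'a::euclidean_space set"
  assumes "open U" "bounded U"
  shows "{x \<in> U. infdist x (frontier U) \<le> \<epsilon>} \<in> lmeasurable"
proof -
  have "{x \<in> U. infdist x (frontier U) \<le> \<epsilon>} = U \<inter> {x. infdist x (frontier U) \<le> \<epsilon>}" by auto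
  moreover have "closed {x. infdist x (frontier U) \<le> \<epsilon>}"
    by (intro closed_Collect_le continuous_intros)
  ultimately have "{x \<in> U. infdist x (frontier U) \<le> \<epsilon>} \<in> sets borel"
    using assms by (metis borel_closed borel_open sets.Int)
  then show ?thesis
    using assms by (intro bounded_set_imp_lmeasurable) (auto intro: bounded_subset sets_completionI_sets)
qed

text \<open>The scaling of volume is available for open sets, so the inner neighbourhood is written
  as the difference of \<open>U\<close> and the open set \<open>?V\<close> of its deeper
  points.\<close>

lemma inner_volume_similitude:
  fixes f :: "'a::euclidean_space \<Rightarrow> 'a"
  assumes f: "similitude r f" and r: "0 < r" and U: "open U" "bounded U" and e: "0 \<le> \<epsilon>"
  shows "inner_volume (f ` U) \<epsilon> = r ^ DIM('a) * inner_volume U (\<epsilon> / r)"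
proof -
  let ?V = "{x \<in> U. \<epsilon> / r < infdist x (frontier U)}"
  have inj: "inj f" using similitude_bij[OF f r] by (rule bij_is_inj)
  have fU: "open (f ` U)" "bounded (f ` U)"
    using similitude_open_image[OF f r U(1)] similitude_bounded_image[OF f U(2)] by auto
  have iff: "infdist (f x) (frontier (f ` U)) \<le> \<epsilon> \<longleftrightarrow> infdist x (frontier U) \<le> \<epsilon> / r" if "x \<in> U" for x
  proof -
    have "cball (f x) \<epsilon> = f ` cball x (\<epsilon> / r)"
      using r by (simp add: similitude_image_ball[OF f r])
    then show ?thesis
      using that e r U fU by (simp add: infdist_frontier_le_iff inj_image_subset_iff[OF inj])
  qed
  then have "{x \<in> f ` U. infdist x (frontier (f ` U)) \<le> \<epsilon>} = f ` (U - ?V)"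
    by auto
  also have "\<dots> = f ` U - f ` ?V" using inj by (rule image_set_diff)
  finally have eq: "{x \<in> f ` U. infdist x (frontier (f ` U)) \<le> \<epsilon>} = f ` U - f ` ?V" .
  have "?V = U \<inter> {x. \<epsilon> / r < infdist x (frontier U)}" by auto
  moreover have "open {x. \<epsilon> / r < infdist x (frontier U)}"
    by (intro open_Collect_less continuous_intros)
  ultimately have V: "open ?V" "bounded ?V" using U by (auto intro: bounded_subset)
  note fV = similitude_open_image[OF f r V(1)] similitude_bounded_image[OF f V(2)]
  have "inner_volume (f ` U) \<epsilon> = measure lebesgue (f ` U) - measure lebesgue (f ` ?V)"
    unfolding inner_volume_def eq
    by (rule measurable_measure_Diff) (use fU fV in \<open>auto intro: lmeasurable_open\<close>)
  also have "\<dots> = r ^ DIM('a) * (measure lebesgue U - measure lebesgue ?V)"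
    by (simp add: measure_similitude_open[OF f r] U V right_diff_distrib)
  also have "measure lebesgue U - measure lebesgue ?V = measure lebesgue (U - ?V)"
    by (rule measurable_measure_Diff[symmetric]) (use U V in \<open>auto intro: lmeasurable_open\<close>)
  also have "U - ?V = {x \<in> U. infdist x (frontier U) \<le> \<epsilon> / r}" by auto
  finally show ?thesis by (simp add: inner_volume_def)
qed

text \<open>A closed ball is connected, so inside a disjoint union of open sets it stays in the one
  that contains its centre. The pieces therefore do not influence each other's inner neighbourhoods,
  even when their frontiers touch.\<close>

lemma inner_volume_Union:
  fixes A :: "'i \<Rightarrow> 'a::euclidean_space set"
  assumes I: "finite I" and A: "\<And>i. i \<in> I \<Longrightarrow> open (A i)" "\<And>i. i \<in> I \<Longrightarrow> bounded (A i)"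
    and disj: "disjoint_family_on A I" and e: "0 \<le> \<epsilon>"
  shows "inner_volume (\<Union>i\<in>I. A i) \<epsilon> = (\<Sum>i\<in>I. inner_volume (A i) \<epsilon>)"
proof -
  let ?U = "\<Union>i\<in>I. A i"
  let ?N = "\<lambda>A. {x \<in> A. infdist x (frontier A) \<le> \<epsilon>}"
  have U: "open ?U" "bounded ?U" using A I by auto
  have iff: "infdist x (frontier ?U) \<le> \<epsilon> \<longleftrightarrow> infdist x (frontier (A i)) \<le> \<epsilon>" if i: "i \<in> I" "x \<in> A i" for i x
  proof -
    have "cball x \<epsilon> \<subseteq> A i" if sub: "cball x \<epsilon> \<subseteq> ?U"
    proof -
      let ?R = "\<Union>j\<in>I - {i}. A j"
      have "A i \<inter> cball x \<epsilon> = {} \<or> ?R \<inter> cball x \<epsilon> = {}"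
      proof (rule connectedD)
        show "connected (cball x \<epsilon>)" by (simp add: convex_connected)
        show "A i \<inter> ?R \<inter> cball x \<epsilon> = {}"
          using disj i by (auto simp: disjoint_family_on_def)
      qed (use A i sub in auto)
      moreover have "x \<in> A i \<inter> cball x \<epsilon>" using i e by simp
      ultimately show ?thesis using sub by blast
    qed
    then have "cball x \<epsilon> \<subseteq> A i \<longleftrightarrow> cball x \<epsilon> \<subseteq> ?U" using i by blast
    then show ?thesis
      using i infdist_frontier_le_iff[OF U _ e, of x] infdist_frontier_le_iff[OF A(1)[OF i(1)] A(2)[OF i(1)] i(2) e] by blast
  qed
  then have "?N ?U = (\<Union>i\<in>I. ?N (A i))" by auto
  then have "inner_volume ?U \<epsilon> = measure lebesgue (\<Union>i\<in>I. ?N (A i))"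
    by (simp add: inner_volume_def)
  also have "\<dots> = (\<Sum>i\<in>I. measure lebesgue (?N (A i)))"
  proof (rule measure_finite_Union)
    show "disjoint_family_on (\<lambda>i. ?N (A i)) I"
      using disj by (auto simp: disjoint_family_on_def)
    show "(\<lambda>i. ?N (A i)) ` I \<subseteq> sets lebesgue"
      using inner_neighbourhood_sets[OF A] by (auto simp: fmeasurableD)
    show "emeasure lebesgue (?N (A i)) \<noteq> \<infinity>" if "i \<in> I" for i
      using inner_neighbourhood_sets[OF A(1)[OF that] A(2)[OF that], of \<epsilon>] by (auto simp: fmeasurable_def)
  qed (use I in auto)
  finally show ?thesis by (simp add: inner_volume_def)
qed

lemma infdist_frontier_le_inradius:
  fixes U :: "'a::euclidean_space set"
  assumes U: "open U" "bounded U" and x: "x \<in> U"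
  shows "0 < infdist x (frontier U)" "infdist x (frontier U) \<le> inradius U"
proof -
  let ?R = "{\<rho>. \<rho> > 0 \<and> (\<exists>x. ball x \<rho> \<subseteq> U)}"
  have "x \<notin> frontier U" using U x by (auto simp: frontier_def interior_open)
  then show pos: "0 < infdist x (frontier U)"
    using frontier_bounded_nonempty[of U] U x
    by (metis frontier_closed empty_iff in_closed_iff_infdist_zero infdist_nonneg less_eq_real_def)
  have "bdd_above ?R"
  proof (rule bdd_aboveI)
    fix \<rho> assume "\<rho> \<in> ?R"
    then obtain y where y: "\<rho> > 0" "ball y \<rho> \<subseteq> U" by auto
    have "diameter (ball y \<rho>) \<le> diameter U" using y U by (intro diameter_subset) auto
    then show "\<rho> \<le> diameter U" using y by (simp add: diameter_ball)
  qed
  have le: "\<rho> \<le> inradius U" if "0 < \<rho>" "\<rho> < infdist x (frontier U)" for \<rho>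
  proof -
    have "cball x \<rho> \<subseteq> U" using that infdist_frontier_le_iff[OF U x, of \<rho>] by auto
    then have "ball x \<rho> \<subseteq> U" using ball_subset_cball by blast
    then show ?thesis
      unfolding inradius_def using that \<open>bdd_above ?R\<close> by (intro cSup_upper) auto
  qed
  show "infdist x (frontier U) \<le> inradius U"
  proof (rule dense_le_bounded[OF pos])
    show "\<rho> \<le> inradius U" if "0 < \<rho>" "\<rho> < infdist x (frontier U)" for \<rho>
      using le that by blast
  qed
qed

text \<open>For every n, the translates of \<open>P\<close> by n equally spaced multiples of
  \<open>v\<close> are disjoint and lie in one fixed ball, so n times the volume of \<open>P\<close>
  stays bounded.\<close>

lemma negligible_if_disjoint_translates:
  fixes P :: "'a::euclidean_space set"
  assumes P: "compact P" and t0: "0 < t0"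
    and disj: "\<And>t. 0 < t \<Longrightarrow> t \<le> t0 \<Longrightarrow> P \<inter> (+) (t *\<^sub>R v) ` P = {}"
  shows "negligible P"
proof -
  have meas: "P \<in> lmeasurable" using P by (rule lmeasurable_compact)
  obtain R where R: "\<And>x. x \<in> P \<Longrightarrow> norm x \<le> R"
    using compact_imp_bounded[OF P] by (auto simp: bounded_iff)
  define B :: "'a set" where "B = cball 0 (R + t0 * norm v)"
  have bound: "real n * measure lebesgue P \<le> measure lebesgue B" for n
  proof -
    define t where "t i = t0 * (real i / real n)" for i
    define Q where "Q i = (+) (t i *\<^sub>R v) ` P" for i
    have Q: "Q i \<in> lmeasurable" "measure lebesgue (Q i) = measure lebesgue P" for i
      using meas by (auto simp: Q_def measurable_translation measure_translation)
    have t: "0 \<le> t i" "t i \<le> t0" if "i < n" for i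
      using that t0 mult_left_mono[of "real i / real n" 1 t0] by (auto simp: t_def divide_le_eq_1)
    have disjQ: "Q i \<inter> Q j = {}" if "i < j" "j < n" for i j
    proof -
      have "t i < t j"
        using that t0 by (simp add: t_def divide_strict_right_mono)
      then have "0 < t j - t i" "t j - t i \<le> t0"
        using that t[of i] t[of j] by auto
      then have "P \<inter> (+) ((t j - t i) *\<^sub>R v) ` P = {}" by (rule disj)
      moreover have "Q i \<inter> Q j = (+) (t i *\<^sub>R v) ` (P \<inter> (+) ((t j - t i) *\<^sub>R v) ` P)"
        unfolding Q_def by (subst image_Int) (auto simp: image_image algebra_simps intro!: injI)
      ultimately show ?thesis by simp
    qed
    have "real n * measure lebesgue P = (\<Sum>i<n. measure lebesgue (Q i))" by (simp add: Q)
    also have "\<dots> = measure lebesgue (\<Union>i<n. Q i)"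
    proof (rule measure_finite_Union[symmetric])
      show "disjoint_family_on Q {..<n}"
        unfolding disjoint_family_on_def by (metis Int_commute disjQ lessThan_iff nat_neq_iff)
      show "Q ` {..<n} \<subseteq> sets lebesgue" using Q by auto
      show "emeasure lebesgue (Q i) \<noteq> \<infinity>" for i
        using fmeasurableD2[OF Q(1)[of i]] unfolding infinity_ennreal_def .
    qed simp
    also have "\<dots> \<le> measure lebesgue B"
    proof (rule measure_mono_fmeasurable)
      show "(\<Union>i<n. Q i) \<subseteq> B"
      proof (clarsimp simp: Q_def B_def)
        fix i x assume "i < n" "x \<in> P"
        then show "norm (t i *\<^sub>R v + x) \<le> R + t0 * norm v"
          using norm_triangle_ineq[of "t i *\<^sub>R v" x] R[of x] t[of i] mult_right_mono[of "t i" t0 "norm v"]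
          by simp
      qed
    qed (use Q in \<open>auto simp: B_def fmeasurableD\<close>)
    finally show ?thesis .
  qed
  have "measure lebesgue P = 0"
  proof (rule ccontr)
    assume "measure lebesgue P \<noteq> 0"
    then have "0 < measure lebesgue P" using measure_nonneg[of lebesgue P] by linarith
    then obtain n where "measure lebesgue B < real n * measure lebesgue P"
      using ex_less_of_nat_mult by blast
    then show False using bound[of n] by linarith
  qed
  then show ?thesis using meas by (simp add: negligible_iff_measure)
qed

text \<open>Points of the level set whose nearest points in \<open>A\<close> lie in nearly the same direction \<open>v\<close>
  cannot stay in the level set when moved along \<open>v\<close>, and finitely many directions suffice.\<close>

lemma negligible_infdist_level_set:
  fixes A :: "'a::euclidean_space set"
  assumes A: "compact A" "A \<noteq> {}" and u: "0 < u"
  shows "negligible {x. infdist x A = u}"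
proof -
  define S where "S = {x. infdist x A = u}"
  \<comment> \<open>Pairs of a level point and a nearest point of \<open>A\<close> whose difference
    is within \<open>u / 4\<close> of \<open>v\<close>. The non-strict inequality makes
    \<open>T v\<close>, and with it the projection \<open>P v\<close>, compact.\<close>
  define T where "T v = {p \<in> S \<times> A. dist (fst p) (snd p) = u \<and> dist (snd p - fst p) v \<le> u / 4}" for v
  define P where "P v = fst ` T v" for v
  have "bounded S"
  proof -
    obtain R where R: "\<And>y. y \<in> A \<Longrightarrow> norm y \<le> R" using compact_imp_bounded[OF A(1)] by (auto simp: bounded_iff)
    have "norm x \<le> R + u" if x: "x \<in> S" for x
    proof -
      obtain y where y: "y \<in> A" "infdist x A = dist x y"
        using infdist_attains_inf[of A x] A compact_imp_closed by blast
      then show ?thesis using x R[of y] norm_triangle_ineq2[of x y] by (simp add: S_def dist_norm)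
    qed
    then show ?thesis by (auto simp: bounded_iff)
  qed
  moreover have "closed S"
    unfolding S_def by (intro closed_Collect_eq continuous_intros)
  ultimately have S: "compact S" by (simp add: compact_eq_bounded_closed)
  have PC: "compact (P v)" for v
  proof -
    have "T v = (S \<times> A) \<inter> {p. dist (fst p) (snd p) = u} \<inter> {p. dist (snd p - fst p) v \<le> u / 4}"
      by (auto simp: T_def)
    moreover have "closed {p. dist (fst p :: 'a) (snd p) = u}"
      by (intro closed_Collect_eq continuous_intros)
    moreover have "closed {p. dist (snd p - fst p :: 'a) v \<le> u / 4}"
      by (intro closed_Collect_le continuous_intros)
    ultimately have "compact (T v)"
      using S A by (simp add: compact_Times compact_Int_closed)
    then show ?thesis
      unfolding P_def by (intro compact_continuous_image continuous_intros)
  qed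
  \<comment> \<open>For \<open>w = y - x\<close> the tolerance \<open>u / 4\<close> gives
    \<open>3 / 4 * u\<^sup>2 \<le> v \<bullet> w\<close> and
    \<open>v \<bullet> v \<le> 25 / 16 * u\<^sup>2\<close>. With \<open>t \<le> 1/2\<close> this
    makes \<open>t * (v \<bullet> v)\<close> smaller than \<open>2 * (v \<bullet> w)\<close>, so the
    step \<open>t *\<^sub>R v\<close> brings the point nearer to \<open>y\<close> than
    \<open>u\<close>.\<close>
  have neg: "negligible (P v)" for v
  proof (rule negligible_if_disjoint_translates[OF PC, of "1/2"])
    fix t :: real assume t: "0 < t" "t \<le> 1/2"
    { fix x assume x: "x \<in> P v" "t *\<^sub>R v + x \<in> P v"
      then obtain y where y: "y \<in> A" "dist x y = u" "dist (y - x) v \<le> u / 4"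
        by (auto simp: P_def T_def)
      define w where "w = y - x"
      have w: "w \<bullet> w = u\<^sup>2" "norm w = u" "norm (w - v) \<le> u / 4"
        using y by (auto simp: w_def dist_norm norm_minus_commute power2_norm_eq_inner[symmetric])
      have "w \<bullet> (w - v) \<le> u * (u / 4)"
        using norm_cauchy_schwarz[of w "w - v"] w(2,3) u
        by (smt (verit) mult_left_mono)
      then have wv: "3 / 4 * u\<^sup>2 \<le> v \<bullet> w"
        using w(1) by (simp add: inner_diff_right inner_commute power2_eq_square)
      have "norm v \<le> 5 / 4 * u"
        using w(2,3) norm_triangle_ineq4[of w "w - v"] by simp
      then have "(norm v)\<^sup>2 \<le> (5 / 4 * u)\<^sup>2" by (intro power_mono) auto
      then have vv: "v \<bullet> v \<le> 25 / 16 * u\<^sup>2"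
        unfolding power2_norm_eq_inner by (simp add: power2_eq_square)
      have "(dist (t *\<^sub>R v + x) y)\<^sup>2 = (t *\<^sub>R v - w) \<bullet> (t *\<^sub>R v - w)"
        by (simp add: dist_norm w_def power2_norm_eq_inner algebra_simps)
      also have "\<dots> = t * (t * (v \<bullet> v)) - t * (2 * (v \<bullet> w)) + u\<^sup>2"
        by (simp add: inner_diff_left inner_diff_right w(1) inner_commute)
      also have "\<dots> < u\<^sup>2"
      proof -
        have "t * (v \<bullet> v) \<le> 1/2 * (25 / 16 * u\<^sup>2)"
          using t vv by (intro mult_mono) auto
        moreover have "0 < u\<^sup>2" using u by simp
        ultimately have "t * (v \<bullet> v) < 2 * (v \<bullet> w)" using wv by linarith
        then show ?thesis using t by simp
      qed
      finally have "dist (t *\<^sub>R v + x) y < u" using u by (simp add: power_less_imp_less_base)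
      moreover have "infdist (t *\<^sub>R v + x) A = u" using x by (auto simp: P_def T_def S_def)
      ultimately have False using infdist_le[OF y(1), of "t *\<^sub>R v + x"] by simp }
    then show "P v \<inter> (+) (t *\<^sub>R v) ` P v = {}" by auto
  qed simp
  have "compact (sphere 0 u :: 'a set)" by simp
  then obtain k where k: "finite k" "sphere 0 u \<subseteq> (\<Union>v\<in>k. ball v (u / 4) :: 'a set)"
    using u unfolding compact_eq_totally_bounded by (meson divide_pos_pos zero_less_numeral)
  have "S \<subseteq> (\<Union>v\<in>k. P v)"
  proof
    fix x assume x: "x \<in> S"
    obtain y where y: "y \<in> A" "infdist x A = dist x y"
      using infdist_attains_inf[of A x] A compact_imp_closed by blast
    then have "y - x \<in> sphere 0 u" using x by (simp add: S_def dist_norm norm_minus_commute)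
    then obtain v where v: "v \<in> k" "dist v (y - x) < u / 4" using k(2) by auto
    then have "(x, y) \<in> T v" using x y by (auto simp: T_def S_def dist_commute)
    then show "x \<in> (\<Union>v\<in>k. P v)" using v by (force simp: P_def)
  qed
  moreover have "negligible (\<Union>v\<in>k. P v)"
    using k(1) neg by (intro negligible_Union) auto
  ultimately show ?thesis unfolding S_def by (rule negligible_subset[rotated])
qed

section \<open>Words, word maps and the volume of a tile\<close>

primrec word_map :: "(nat \<Rightarrow> 'a \<Rightarrow> 'a) \<Rightarrow> nat list \<Rightarrow> 'a \<Rightarrow> 'a" where
  "word_map \<Phi> [] = id"
| "word_map \<Phi> (j # w) = \<Phi> j \<circ> word_map \<Phi> w"

lemma words_0: "words J 0 = {[]}"
  by (auto simp: words_def)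

lemma words_Suc: "words J (Suc k) = (\<Union>j\<in>{1..J}. (#) j ` words J k)"
  by (auto simp: words_def length_Suc_conv)

lemma finite_words: "finite (words J k)"
  by (induction k) (auto simp: words_0 words_Suc)

lemma set_map_funpow: "(set_map J \<Phi> ^^ k) A = (\<Union>w\<in>words J k. word_map \<Phi> w ` A)"
proof (induction k)
  case (Suc k)
  have "\<Phi> j ` (\<Union>w\<in>words J k. word_map \<Phi> w ` A) = (\<Union>w\<in>words J k. word_map \<Phi> (j # w) ` A)" for j
    by (subst image_UN) (simp add: image_image)
  moreover have "(\<Union>w\<in>words J (Suc k). B w) = (\<Union>j\<in>{1..J}. \<Union>w\<in>words J k. B (j # w))"
    for B :: "nat list \<Rightarrow> 'a set"
    unfolding words_Suc by blast
  moreover have step: "(set_map J \<Phi> ^^ Suc k) A = set_map J \<Phi> (\<Union>w\<in>words J k. word_map \<Phi> w ` A)"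
    by (simp only: funpow.simps comp_apply Suc)
  ultimately show ?case
    unfolding step by (simp only: set_map_def)
qed (simp add: words_0)

lemma similitude_word_map:
  assumes "\<And>j. j \<in> {1..J} \<Longrightarrow> similitude (r j) (\<Phi> j)" "set w \<subseteq> {1..J}"
  shows "similitude (word_ratio r w) (word_map \<Phi> w)"
  using assms(2)
proof (induction w)
  case (Cons j w)
  then have "similitude (r j) (\<Phi> j)" "similitude (word_ratio r w) (word_map \<Phi> w)"
    using assms(1) by auto
  then show ?case by (simp add: similitude_def word_ratio_def)
qed (simp add: similitude_def word_ratio_def)

lemma word_map_image_subset:
  assumes "\<And>j. j \<in> {1..J} \<Longrightarrow> \<Phi> j ` U \<subseteq> U" "set w \<subseteq> {1..J}"
  shows "word_map \<Phi> w ` U \<subseteq> U"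
  using assms(2)
proof (induction w)
  case (Cons j w)
  have "\<Phi> j ` word_map \<Phi> w ` U \<subseteq> \<Phi> j ` U"
    using Cons by (intro image_mono) simp
  also have "\<dots> \<subseteq> U" using Cons.prems by (intro assms(1)) simp
  finally show ?case by (simp only: word_map.simps image_comp)
qed simp

text \<open>Equal first letters are stripped by injectivity and leave shorter distinct words;
  different first letters put the images into disjoint first-level copies of \<open>U\<close>. Equal
  length excludes that one word is a prefix of the other.\<close>

lemma disjoint_word_images:
  assumes inj: "\<And>j. j \<in> {1..J} \<Longrightarrow> inj (\<Phi> j)"
    and osc: "\<And>j. j \<in> {1..J} \<Longrightarrow> \<Phi> j ` U \<subseteq> U" "disjoint_family_on (\<lambda>j. \<Phi> j ` U) {1..J}"
    and vw: "v \<in> words J k" "w \<in> words J k" "v \<noteq> w"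
  shows "word_map \<Phi> v ` U \<inter> word_map \<Phi> w ` U = {}"
  using vw
proof (induction k arbitrary: v w)
  case (Suc k)
  obtain i v' where v: "v = i # v'" "i \<in> {1..J}" "v' \<in> words J k"
    using Suc.prems(1) by (auto simp: words_Suc)
  obtain j w' where w: "w = j # w'" "j \<in> {1..J}" "w' \<in> words J k"
    using Suc.prems(2) by (auto simp: words_Suc)
  note eq = v(1) w(1) and mem = v(2) w(2) v(3) w(3)
  show ?case
  proof (cases "i = j")
    case True
    then have "word_map \<Phi> v' ` U \<inter> word_map \<Phi> w' ` U = {}"
      using Suc.IH[OF mem(3,4)] Suc.prems(3) eq by simp
    then show ?thesis
      using image_Int[OF inj[OF mem(1)], of "word_map \<Phi> v' ` U" "word_map \<Phi> w' ` U"] True eq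
      by (simp add: image_comp)
  next
    case False
    have sub: "word_map \<Phi> x ` U \<subseteq> U" if "x \<in> words J k" for x
      using that by (intro word_map_image_subset[OF osc(1)]) (auto simp: words_def)
    have "(\<Phi> i ` word_map \<Phi> v' ` U) \<inter> (\<Phi> j ` word_map \<Phi> w' ` U) \<subseteq> \<Phi> i ` U \<inter> \<Phi> j ` U"
      by (intro Int_mono image_mono sub mem)
    also have "\<Phi> i ` U \<inter> \<Phi> j ` U = {}"
      using osc(2) mem False unfolding disjoint_family_on_def by blast
    finally show ?thesis unfolding eq by (simp only: word_map.simps image_comp subset_empty)
  qed
qed (simp add: words_0)

text \<open>The first tile lies in \<open>interior C\<close>, so the open set condition separates
  its copies along all words of one length and their inner volumes add up.\<close>

lemma inner_volume_tile:
  fixes \<Phi> :: "nat \<Rightarrow> 'a::euclidean_space \<Rightarrow> 'a"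
  assumes ratios: "\<And>j. j \<in> {1..J} \<Longrightarrow> 0 < r j"
    and similitudes: "\<And>j. j \<in> {1..J} \<Longrightarrow> similitude (r j) (\<Phi> j)"
    and osc: "\<And>j. j \<in> {1..J} \<Longrightarrow> \<Phi> j ` interior C \<subseteq> interior C"
      "disjoint_family_on (\<lambda>j. \<Phi> j ` interior C) {1..J}"
    and C: "bounded C" and e: "0 \<le> \<epsilon>"
  shows "inner_volume (tile J \<Phi> C (Suc k)) \<epsilon>
    = (\<Sum>w\<in>words J k. word_ratio r w ^ DIM('a) * inner_volume (tile J \<Phi> C 1) (\<epsilon> / word_ratio r w))"
proof -
  let ?G = "interior (C - set_map J \<Phi> C)"
  have G: "tile J \<Phi> C 1 = ?G" by (simp add: tile_def)
  have GC: "?G \<subseteq> interior C" by (intro interior_mono) auto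
  have bG: "bounded ?G" using C by (rule bounded_subset) (use interior_subset in blast)
  have pos: "0 < word_ratio r w" if "w \<in> words J k" for w
    using word_ratio_pos[of J r w] ratios that by (auto simp: words_def)
  have sim: "similitude (word_ratio r w) (word_map \<Phi> w)" if "w \<in> words J k" for w
    using similitude_word_map[of J r \<Phi> w] similitudes that by (auto simp: words_def)
  have inj: "inj (\<Phi> j)" if "j \<in> {1..J}" for j
    using similitude_bij[OF similitudes ratios] that by (simp add: bij_is_inj)
  have "inner_volume (tile J \<Phi> C (Suc k)) \<epsilon> = inner_volume (\<Union>w\<in>words J k. word_map \<Phi> w ` ?G) \<epsilon>"
    by (simp add: tile_def set_map_funpow)
  also have "\<dots> = (\<Sum>w\<in>words J k. inner_volume (word_map \<Phi> w ` ?G) \<epsilon>)"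
  proof (rule inner_volume_Union[OF finite_words _ _ _ e])
    show "disjoint_family_on (\<lambda>w. word_map \<Phi> w ` ?G) (words J k)"
      unfolding disjoint_family_on_def
    proof (intro ballI impI)
      fix v w assume "v \<in> words J k" "w \<in> words J k" "v \<noteq> w"
      then have "word_map \<Phi> v ` interior C \<inter> word_map \<Phi> w ` interior C = {}"
        by - (rule disjoint_word_images[OF inj osc]; assumption)
      then show "word_map \<Phi> v ` ?G \<inter> word_map \<Phi> w ` ?G = {}"
        using Int_mono[OF image_mono[OF GC] image_mono[OF GC], of "word_map \<Phi> v" "word_map \<Phi> w"] by simp
    qed
    fix w assume w: "w \<in> words J k"
    show "open (word_map \<Phi> w ` ?G)" by (rule similitude_open_image[OF sim[OF w] pos[OF w] open_interior])
    show "bounded (word_map \<Phi> w ` ?G)" by (rule similitude_bounded_image[OF sim[OF w] bG])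
  qed
  also have "\<dots> = (\<Sum>w\<in>words J k. word_ratio r w ^ DIM('a) * inner_volume ?G (\<epsilon> / word_ratio r w))"
    by (intro sum.cong refl inner_volume_similitude sim pos bG e open_interior)
  finally show ?thesis unfolding G .
qed

section \<open>Mellin transform of the tube volume\<close>

lemma of_real_powr_exp: "0 < y \<Longrightarrow> of_real y powr z = exp (z * of_real (ln y))" for z :: complex
  by (simp add: powr_def Ln_of_real)

lemma norm_integral_le:
  fixes f :: "'a \<Rightarrow> 'b::{banach,second_countable_topology}"
  assumes "integrable M f" "integrable M g" "\<And>x. x \<in> space M \<Longrightarrow> norm (f x) \<le> g x"
  shows "norm (integral\<^sup>L M f) \<le> integral\<^sup>L M g"
  using integral_norm_bound[of M f] integral_mono[OF integrable_norm[OF assms(1)] assms(2,3)]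
  by linarith

text \<open>Fubini between the Bochner integral over \<open>M\<close> and the gauge integral in
  which contour integrals are expressed. The cut-off \<open>F\<close> lives on a product of finite
  measure, where boundedness already gives integrability.\<close>

lemma (in finite_measure) integral_swap:
  fixes f :: "'a \<Rightarrow> real \<Rightarrow> complex"
  assumes meas: "case_prod f \<in> borel_measurable (M \<Otimes>\<^sub>M lborel)"
    and bound: "\<And>x t. x \<in> space M \<Longrightarrow> t \<in> {a..b} \<Longrightarrow> norm (f x t) \<le> B"
  shows "integral {a..b} (\<lambda>t. \<integral>x. f x t \<partial>M) = (\<integral>x. integral {a..b} (f x) \<partial>M)"
    and "integrable M (\<lambda>x. integral {a..b} (f x))"
    and "(\<lambda>t. \<integral>x. f x t \<partial>M) integrable_on {a..b}"
proof -
  interpret pair_sigma_finite M lborel ..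
  define F where "F x t = indicator {a..b} t *\<^sub>R f x t" for x t
  have 1: "integrable (M \<Otimes>\<^sub>M lborel) (case_prod F)"
  proof (rule integrableI_bounded_set)
    show "space M \<times> {a..b} \<in> sets (M \<Otimes>\<^sub>M lborel)" by simp
    show "case_prod F \<in> borel_measurable (M \<Otimes>\<^sub>M lborel)"
      using meas unfolding F_def by measurable
    show "emeasure (M \<Otimes>\<^sub>M lborel) (space M \<times> {a..b}) < \<infinity>"
      by (subst lborel.emeasure_pair_measure_Times)
        (auto simp: ennreal_mult_less_top emeasure_eq_measure emeasure_lborel_Icc_eq)
    show "AE p in M \<Otimes>\<^sub>M lborel. p \<in> space M \<times> {a..b} \<longrightarrow> norm (case_prod F p) \<le> B"
      using bound by (intro AE_I2) (auto simp: F_def)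
    show "AE p in M \<Otimes>\<^sub>M lborel. p \<notin> space M \<times> {a..b} \<longrightarrow> case_prod F p = 0"
      by (intro AE_I2) (auto simp: F_def space_pair_measure indicator_def)
  qed
  have inner: "(\<integral>t. F x t \<partial>lborel) = integral {a..b} (f x)" if x: "x \<in> space M" for x
  proof -
    have "set_integrable lborel {a..b} (f x)"
      unfolding set_integrable_def
    proof (rule integrableI_bounded_set_indicator)
      show "f x \<in> borel_measurable lborel"
        using measurable_compose[OF measurable_Pair1'[OF x] meas] by simp
      show "AE t in lborel. t \<in> {a..b} \<longrightarrow> norm (f x t) \<le> B"
        using bound[OF x] by auto
    qed (auto simp: emeasure_lborel_Icc_eq)
    from set_borel_integral_eq_integral(2)[OF this] show ?thesis
      by (simp add: F_def set_lebesgue_integral_def)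
  qed
  have "integrable M (\<lambda>x. \<integral>t. F x t \<partial>lborel)"
    using integrable_fst[OF 1] .
  moreover have "integrable M (\<lambda>x. \<integral>t. F x t \<partial>lborel) \<longleftrightarrow> integrable M (\<lambda>x. integral {a..b} (f x))"
    by (rule Bochner_Integration.integrable_cong) (simp_all add: inner)
  ultimately show "integrable M (\<lambda>x. integral {a..b} (f x))" by blast
  have outer: "(\<integral>x. F x t \<partial>M) = indicator {a..b} t *\<^sub>R (\<integral>x. f x t \<partial>M)" for t
    by (simp add: F_def)
  have si: "set_integrable lborel {a..b} (\<lambda>t. \<integral>x. f x t \<partial>M)"
    using integrable_snd[OF 1] by (simp add: outer set_integrable_def)
  then show "(\<lambda>t. \<integral>x. f x t \<partial>M) integrable_on {a..b}"
    by (rule set_borel_integral_eq_integral(1))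
  have "integral {a..b} (\<lambda>t. \<integral>x. f x t \<partial>M) = (\<integral>t. (\<integral>x. F x t \<partial>M) \<partial>lborel)"
    using set_borel_integral_eq_integral(2)[OF si] by (simp add: outer set_lebesgue_integral_def)
  also have "\<dots> = (\<integral>x. (\<integral>t. F x t \<partial>lborel) \<partial>M)"
    by (rule Fubini_integral[OF 1])
  also have "\<dots> = (\<integral>x. integral {a..b} (f x) \<partial>M)"
    by (rule Bochner_Integration.integral_cong[OF refl inner])
  finally show "integral {a..b} (\<lambda>t. \<integral>x. f x t \<partial>M) = (\<integral>x. integral {a..b} (f x) \<partial>M)" .
qed

lemma has_integral_of_real_powr:
  fixes w :: complex
  assumes "w \<noteq> 0" "0 < a" "a \<le> b"
  shows "((\<lambda>u. of_real u powr (w - 1)) has_integral (of_real b powr w - of_real a powr w) / w) {a..b}"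
proof -
  have "((\<lambda>u. of_real u powr (w - 1)) has_integral of_real b powr w / w - of_real a powr w / w) {a..b}"
  proof (rule fundamental_theorem_of_calculus)
    fix u assume u: "u \<in> {a..b}"
    have "((\<lambda>z. z powr w / w) has_field_derivative (of_real u powr (w - 1))) (at (of_real u))"
      using u assms by (auto intro!: derivative_eq_intros)
    then show "((\<lambda>u. of_real u powr w / w) has_vector_derivative of_real u powr (w - 1)) (at u within {a..b})"
      by (rule has_vector_derivative_real_field)
  qed (use assms in auto)
  then show ?thesis by (simp add: diff_divide_distrib)
qed

text \<open>Volume and distance to the boundary are abstracted to a finite measure \<open>M\<close> and a function
  \<open>\<delta>\<close>, so that \<open>V\<close> below stands for \<open>V\<^sub>G\<close>.\<close>

locale inner_tube = finite_measure M for M :: "'b measure" +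
  fixes \<delta> :: "'b \<Rightarrow> real" and d :: nat and g h :: real and \<kappa> :: "nat \<Rightarrow> real" and lam :: "real \<Rightarrow> real"
  assumes measurable_\<delta> [measurable]: "\<delta> \<in> borel_measurable M"
    and \<delta>_pos: "\<And>x. x \<in> space M \<Longrightarrow> 0 < \<delta> x" and \<delta>_le: "\<And>x. x \<in> space M \<Longrightarrow> \<delta> x \<le> g"
    and h_pos: "0 < h" and h_le: "h \<le> g"
    and small: "\<And>u. 0 < u \<Longrightarrow> u < h \<Longrightarrow> measure M {x \<in> space M. \<delta> x \<le> u} = (\<Sum>i<d. \<kappa> i * u ^ (d - i))"
    and large: "\<And>u. h \<le> u \<Longrightarrow> u \<le> g \<Longrightarrow> measure M {x \<in> space M. \<delta> x \<le> u} = lam u"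
    and level_null: "\<And>u. 0 < u \<Longrightarrow> measure M {x \<in> space M. \<delta> x = u} = 0"
    and lam_continuous: "continuous_on {h..g} lam"
begin

definition V :: "real \<Rightarrow> real" where
  "V u = measure M {x \<in> space M. \<delta> x \<le> u}"

definition m :: "'b \<Rightarrow> real" where
  "m x = max h (\<delta> x)"

definition bracket :: "complex \<Rightarrow> complex" where
  "bracket s = (\<Sum>i<d. of_real h powr (s - of_nat i) / (s - of_nat i) * of_real (\<kappa> i))
      + of_real g powr (s - of_nat d) / (s - of_nat d) * of_real (- measure M (space M))
      + Lambda_integral d h g lam s"

lemma measurable_m [measurable]: "m \<in> borel_measurable M"
  unfolding m_def by measurable

lemma m_pos: "0 < m x" and h_le_m: "h \<le> m x"
  using h_pos by (auto simp: m_def)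

lemma m_le: "x \<in> space M \<Longrightarrow> m x \<le> g"
  using \<delta>_le h_le by (auto simp: m_def)

lemma norm_m_powr_le:
  assumes "Re w \<le> 0"
  shows "norm (of_real (m x) powr w) \<le> h powr Re w"
  using m_pos[of x] h_le_m[of x] h_pos assms powr_mono2'[of "Re w" h "m x"]
  by (simp add: norm_powr_real_powr)

lemma integrable_m_powr: "integrable M (\<lambda>x. complex_of_real (m x) powr w)"
proof (rule integrable_const_bound)
  show "AE x in M. norm (complex_of_real (m x) powr w) \<le> max (h powr Re w) (g powr Re w)"
  proof (rule AE_I2)
    fix x assume x: "x \<in> space M"
    then show "norm (complex_of_real (m x) powr w) \<le> max (h powr Re w) (g powr Re w)"
      using m_pos[of x] h_le_m[of x] h_pos powr_mono2'[of "Re w" h "m x"]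
        m_le[OF x] powr_mono2[of "Re w" "m x" g]
      by (cases "Re w \<le> 0") (auto simp: norm_powr_real_powr)
  qed
  have "(\<lambda>x. exp (w * of_real (ln (m x)))) \<in> borel_measurable M" by measurable
  then show "(\<lambda>x. complex_of_real (m x) powr w) \<in> borel_measurable M"
    using m_pos by (simp add: of_real_powr_exp)
qed

text \<open>Between \<open>h\<close> and \<open>g\<close>, \<open>lam u\<close> is the integral over
  \<open>M\<close> of the indicator of \<delta> x \<le> u. After Fubini the inner integral of the
  power runs from \<open>m x\<close> to \<open>g\<close>, which is where the maximum of
  \<open>h\<close> and \<delta> originates.\<close>

lemma Lambda_integral_eq:
  assumes "s \<noteq> of_nat d"
  shows "Lambda_integral d h g lam s
    = (of_real g powr (s - of_nat d) * of_real (measure M (space M))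
       - (\<integral>x. of_real (m x) powr (s - of_nat d) \<partial>M)) / (s - of_nat d)"
proof -
  define w where "w = s - of_nat d"
  have w: "w \<noteq> 0" using assms by (simp add: w_def)
  define f where "f x u = of_real (if \<delta> x \<le> u then 1 else 0) * exp ((w - 1) * of_real (ln u))" for x and u :: real
  have "Lambda_integral d h g lam s = integral {h..g} (\<lambda>u. \<integral>x. f x u \<partial>M)"
    unfolding Lambda_integral_def
  proof (rule integral_cong)
    fix u assume u: "u \<in> {h..g}"
    define S where "S = {x \<in> space M. \<delta> x \<le> u}"
    have "(\<integral>x. f x u \<partial>M) = (\<integral>x. of_real (indicator S x) * exp ((w - 1) * of_real (ln u)) \<partial>M)"
      by (rule Bochner_Integration.integral_cong) (auto simp: f_def S_def)
    also have "\<dots> = (\<integral>x. of_real (indicator S x) \<partial>M) * exp ((w - 1) * of_real (ln u))"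
      by (rule integral_mult_left_zero)
    also have "(\<integral>x. of_real (indicator S x) \<partial>M) = complex_of_real (measure M (S \<inter> space M))"
      by (simp only: integral_complex_of_real Bochner_Integration.integral_indicator)
    also have "S \<inter> space M = {x \<in> space M. \<delta> x \<le> u}" by (auto simp: S_def)
    also have "complex_of_real (measure M {x \<in> space M. \<delta> x \<le> u}) = of_real (lam u)"
      using large u by simp
    finally show "of_real u powr (s - of_nat d - 1) * of_real (lam u) = (\<integral>x. f x u \<partial>M)"
      using u h_pos by (simp add: of_real_powr_exp w_def)
  qed
  also have "\<dots> = (\<integral>x. integral {h..g} (f x) \<partial>M)"
  proof (rule integral_swap(1))
    show "case_prod f \<in> borel_measurable (M \<Otimes>\<^sub>M lborel)"
      unfolding f_def by measurable
    fix x u assume "u \<in> {h..g}"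
    then have u: "0 < u" "h \<le> u" "u \<le> g" using h_pos by auto
    have "norm (f x u) \<le> norm (of_real u powr (w - 1))"
      using u by (simp add: f_def of_real_powr_exp)
    also have "\<dots> \<le> max (h powr Re (w - 1)) (g powr Re (w - 1))"
      using u h_pos powr_mono2'[of "Re (w - 1)" h u] powr_mono2[of "Re (w - 1)" u g]
      by (cases "Re (w - 1) \<le> 0") (auto simp: norm_powr_real_powr simp del: minus_complex.sel)
    finally show "norm (f x u) \<le> max (h powr Re (w - 1)) (g powr Re (w - 1))" .
  qed
  also have "\<dots> = (\<integral>x. (of_real g powr w - of_real (m x) powr w) / w \<partial>M)"
  proof (rule Bochner_Integration.integral_cong[OF refl])
    fix x assume x: "x \<in> space M"
    have "((\<lambda>u. if u \<in> {m x..g} then of_real u powr (w - 1) else 0) has_integral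
        (of_real g powr w - of_real (m x) powr w) / w) {h..g}"
      using has_integral_of_real_powr[OF w m_pos m_le[OF x]] h_le_m[of x]
      by (subst has_integral_restrict) auto
    moreover have "(if u \<in> {m x..g} then of_real u powr (w - 1) else 0) = f x u" if "u \<in> {h..g}" for u
      using that h_pos by (auto simp: f_def m_def of_real_powr_exp)
    ultimately have "(f x has_integral (of_real g powr w - of_real (m x) powr w) / w) {h..g}"
      by (subst has_integral_cong[symmetric]) auto
    then show "integral {h..g} (f x) = (of_real g powr w - of_real (m x) powr w) / w"
      by (rule integral_unique)
  qed
  also have "\<dots> = (of_real g powr w * of_real (measure M (space M)) - (\<integral>x. of_real (m x) powr w \<partial>M)) / w"
    using integrable_m_powr by (subst integral_divide_zero) (simp add: mult.commute scaleR_conv_of_real)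
  finally show ?thesis by (simp add: w_def)
qed

text \<open>Both terms containing \<open>g\<close> cancel.\<close>

lemma bracket_eq:
  assumes "s \<noteq> of_nat d"
  shows "bracket s = (\<Sum>i<d. of_real h powr (s - of_nat i) / (s - of_nat i) * of_real (\<kappa> i))
    + (\<integral>x. of_real (m x) powr (s - of_nat d) \<partial>M) / (of_nat d - s)"
proof -
  have "of_nat d - s = - (s - of_nat d)" by simp
  then show ?thesis
    using assms unfolding bracket_def Lambda_integral_eq[OF assms]
    by (simp add: divide_simps) (simp add: algebra_simps)
qed

text \<open>As \<open>m x\<close> is at least \<open>h\<close>, for \<open>Re s \<le> real d\<close>
  every power in \<open>bracket_eq\<close> is bounded by a constant times
  \<open>h powr Re s\<close>. The parameter \<rho> will be the height of a horizontal line, or 1 far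
  to the left.\<close>

lemma bracket_bound:
  obtains K where "0 \<le> K" "\<And>s \<rho>. Re s \<le> real d \<Longrightarrow> 0 < \<rho> \<Longrightarrow> (\<And>i. i \<le> d \<Longrightarrow> \<rho> \<le> norm (s - of_nat i)) \<Longrightarrow>
    norm (bracket s) \<le> K / \<rho> * h powr Re s"
proof
  let ?K = "(\<Sum>i<d. \<bar>\<kappa> i\<bar> * h powr (- real i)) + measure M (space M) * h powr (- real d)"
  show "0 \<le> ?K" by (intro add_nonneg_nonneg sum_nonneg mult_nonneg_nonneg) auto
  fix s and \<rho> :: real
  assume s: "Re s \<le> real d" and \<rho>: "0 < \<rho>" "\<And>i. i \<le> d \<Longrightarrow> \<rho> \<le> norm (s - of_nat i)"
  have "s \<noteq> of_nat d" using \<rho>(1) \<rho>(2)[of d] by auto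
  have 1: "norm (\<Sum>i<d. of_real h powr (s - of_nat i) / (s - of_nat i) * of_real (\<kappa> i))
      \<le> (\<Sum>i<d. (\<bar>\<kappa> i\<bar> * h powr (- real i)) * (h powr Re s / \<rho>))"
  proof (rule sum_norm_le)
    fix i assume i: "i \<in> {..<d}"
    have "norm (complex_of_real h powr (s - of_nat i)) = h powr (- real i) * h powr Re s"
      using h_pos by (simp add: norm_powr_real_powr flip: powr_add)
    moreover have "0 < norm (s - of_nat i)" "\<rho> \<le> norm (s - of_nat i)"
      using \<rho>(2)[of i] i \<rho>(1) by auto
    ultimately show "norm (of_real h powr (s - of_nat i) / (s - of_nat i) * of_real (\<kappa> i))
        \<le> \<bar>\<kappa> i\<bar> * h powr (- real i) * (h powr Re s / \<rho>)"
      using divide_left_mono[of \<rho> "norm (s - of_nat i)" "\<bar>\<kappa> i\<bar> * (h powr (- real i) * h powr Re s)"] \<rho>(1)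
      by (simp add: norm_mult norm_divide mult_ac)
  qed
  have "norm (\<integral>x. of_real (m x) powr (s - of_nat d) \<partial>M) \<le> (\<integral>x. h powr Re (s - of_nat d) \<partial>M)"
  proof (rule norm_integral_le[OF integrable_m_powr])
    show "norm (complex_of_real (m x) powr (s - of_nat d)) \<le> h powr Re (s - of_nat d)" for x
      by (rule norm_m_powr_le) (use s in simp)
  qed simp
  also have "\<dots> = measure M (space M) * h powr (- real d) * h powr Re s"
    using h_pos by (simp flip: powr_add)
  finally have 2: "norm ((\<integral>x. of_real (m x) powr (s - of_nat d) \<partial>M) / (of_nat d - s))
      \<le> measure M (space M) * h powr (- real d) * (h powr Re s / \<rho>)"
    using frac_le[OF _ _ \<rho>(1) \<rho>(2)[of d]] by (simp add: norm_divide norm_minus_commute)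
  have "?K / \<rho> * h powr Re s = (\<Sum>i<d. (\<bar>\<kappa> i\<bar> * h powr (- real i)) * (h powr Re s / \<rho>))
      + measure M (space M) * h powr (- real d) * (h powr Re s / \<rho>)"
    unfolding sum_distrib_right[symmetric] by (simp add: add_divide_distrib ring_distribs mult_ac)
  then show "norm (bracket s) \<le> ?K / \<rho> * h powr Re s"
    unfolding bracket_eq[OF \<open>s \<noteq> of_nat d\<close>] using norm_triangle_mono[OF 1 2] by simp
qed

text \<open>The Lambda term is entire by differentiation under an integral over a compact interval
  away from 0, so just the zeros of the explicit denominators are left out.\<close>

lemma holomorphic_bracket: "bracket holomorphic_on UNIV - of_nat ` {..d}"
proof -
  have "(\<lambda>s. integral (cbox h g) (\<lambda>u. exp ((s - of_nat d - 1) * of_real (ln u)) * of_real (lam u))) holomorphic_on UNIV"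
  proof (rule leibniz_rule_holomorphic[where fx = "\<lambda>s u. exp ((s - of_nat d - 1) * of_real (ln u)) * of_real (ln u) * of_real (lam u)"])
    fix s :: complex and u :: real
    show "((\<lambda>s. exp ((s - of_nat d - 1) * of_real (ln u)) * of_real (lam u)) has_field_derivative
        exp ((s - of_nat d - 1) * of_real (ln u)) * of_real (ln u) * of_real (lam u)) (at s within UNIV)"
      by (auto intro!: derivative_eq_intros)
  next
    fix s :: complex
    show "(\<lambda>u. exp ((s - of_nat d - 1) * of_real (ln u)) * of_real (lam u)) integrable_on cbox h g"
      using h_pos lam_continuous by (intro integrable_continuous continuous_intros) auto
  next
    have "continuous_on (UNIV \<times> cbox h g) (\<lambda>p. lam (snd p))"
      by (rule continuous_on_compose2[OF lam_continuous]) (auto intro!: continuous_intros)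
    then show "continuous_on (UNIV \<times> cbox h g)
        (\<lambda>(s, u). exp ((s - of_nat d - 1) * of_real (ln u)) * of_real (ln u) * complex_of_real (lam u))"
      using h_pos unfolding case_prod_unfold by (intro continuous_intros) auto
  qed auto
  moreover have "integral (cbox h g) (\<lambda>u. exp ((s - of_nat d - 1) * of_real (ln u)) * of_real (lam u))
      = Lambda_integral d h g lam s" for s
    unfolding Lambda_integral_def using h_pos by (auto intro!: integral_cong simp: of_real_powr_exp)
  ultimately have "Lambda_integral d h g lam holomorphic_on UNIV - of_nat ` {..d}"
    by (auto intro: holomorphic_on_subset)
  then show ?thesis
    unfolding bracket_def by (intro holomorphic_intros) auto
qed

section \<open>Perron integrals of the bracket\<close>

definition vertical :: "real \<Rightarrow> real \<Rightarrow> real \<Rightarrow> complex" where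
  "vertical c \<tau> u = integral {-\<tau>..\<tau>} (\<lambda>t. of_real u powr (of_nat d - Complex c t) * bracket (Complex c t)) / (2 * pi)"

text \<open>The distance term carries \<open>d - s\<close> in exponent and denominator, whose
  imaginary part is \<open>-t\<close>; this brings \<open>perron\<close> into the same
  shape.\<close>

lemma perron_eq_reflected:
  "perron \<tau> y b = integral {-\<tau>..\<tau>} (\<lambda>t. of_real y powr Complex b (- t) / Complex b (- t)) / (2 * pi)"
  using Henstock_Kurzweil_Integration.integral_reflect_real[of \<tau> "-\<tau>" "\<lambda>t. of_real y powr Complex b t / Complex b t"]
  unfolding perron_def by (simp del: Henstock_Kurzweil_Integration.integral_reflect_real)

lemma perron_m_swap:
  assumes u: "0 < u" and c: "c < real d"
  shows "integral {-\<tau>..\<tau>} (\<lambda>t. \<integral>x. of_real (u / m x) powr Complex (real d - c) (- t) / Complex (real d - c) (- t) \<partial>M) / (2 * pi)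
      = (\<integral>x. perron \<tau> (u / m x) (real d - c) \<partial>M)" (is ?eq)
    and "integrable M (\<lambda>x. perron \<tau> (u / m x) (real d - c))" (is ?int)
    and "(\<lambda>t. \<integral>x. of_real (u / m x) powr Complex (real d - c) (- t) / Complex (real d - c) (- t) \<partial>M)
      integrable_on {-\<tau>..\<tau>}" (is ?int')
proof -
  define f where "f x t = exp (Complex (real d - c) (- t) * of_real (ln (u / m x))) / Complex (real d - c) (- t)" for x t
  have f: "of_real (u / m x) powr Complex (real d - c) (- t) / Complex (real d - c) (- t) = f x t" for x t
    using u m_pos[of x] by (simp add: f_def of_real_powr_exp del: of_real_divide)
  have meas: "case_prod f \<in> borel_measurable (M \<Otimes>\<^sub>M lborel)"
    unfolding f_def Complex_eq by measurable
  have bound: "norm (f x t) \<le> (u / h) powr (real d - c) / (real d - c)" for x t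
  proof -
    have "norm (f x t) = (u / m x) powr (real d - c) / norm (Complex (real d - c) (- t))"
      unfolding f[symmetric] norm_divide using u m_pos[of x]
      by (subst norm_powr_real_powr) (simp_all add: less_imp_le del: of_real_divide)
    also have "\<dots> \<le> (u / h) powr (real d - c) / (real d - c)"
      using u c m_pos[of x] h_le_m[of x] h_pos abs_Re_le_cmod[of "Complex (real d - c) (- t)"]
      by (intro frac_le powr_mono2 divide_left_mono) auto
    finally show ?thesis .
  qed
  have p: "perron \<tau> (u / m x) (real d - c) = integral {-\<tau>..\<tau>} (f x) / (2 * pi)" for x
    unfolding perron_eq_reflected f ..
  show ?int
    unfolding p by (intro integrable_divide integral_swap(2)[OF meas bound])
  show ?int'
    unfolding f by (rule integral_swap(3)[OF meas bound])
  show ?eq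
    unfolding p f integral_swap(1)[OF meas bound] by simp
qed

text \<open>Absorbing the power of \<open>u\<close> turns \<open>h powr (s - i)\<close> into
  \<open>u ^ (d - i)\<close> times \<open>(h / u) powr (s - i)\<close>, and
  \<open>m x powr (s - d)\<close> into \<open>(u / m x) powr (d - s)\<close>. Each is a Perron
  kernel of positive abscissa.\<close>

lemma vertical_eq:
  assumes u: "0 < u" and c: "real d - 1 < c" "c < real d"
  shows "vertical c \<tau> u = (\<Sum>i<d. of_real (\<kappa> i * u ^ (d - i)) * perron \<tau> (h / u) (c - real i))
    + (\<integral>x. perron \<tau> (u / m x) (real d - c) \<partial>M)"
proof -
  have ci: "real i < c" if "i < d" for i using that c by linarith
  have eq: "of_real u powr (of_nat d - Complex c t) * bracket (Complex c t)
      = (\<Sum>i<d. of_real (\<kappa> i * u ^ (d - i)) * (of_real (h / u) powr Complex (c - real i) t / Complex (c - real i) t))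
      + (\<integral>x. of_real (u / m x) powr Complex (real d - c) (- t) / Complex (real d - c) (- t) \<partial>M)" for t
  proof -
    define s where "s = Complex c t"
    have s: "s \<noteq> of_nat d" using c by (auto simp: s_def complex_eq_iff)
    have i: "Complex (c - real i) t = s - of_nat i" for i by (simp add: s_def complex_eq_iff)
    have ds: "Complex (real d - c) (- t) = of_nat d - s" by (simp add: s_def complex_eq_iff)
    have 1: "of_real u powr (of_nat d - s) * (of_real h powr (s - of_nat i) / (s - of_nat i) * of_real (\<kappa> i))
        = of_real (\<kappa> i * u ^ (d - i)) * (of_real (h / u) powr (s - of_nat i) / (s - of_nat i))"
      if "i < d" for i
    proof -
      have "of_real (u ^ (d - i)) = exp (of_nat (d - i) * complex_of_real (ln u))"
        using u by (simp add: exp_of_nat_mult exp_of_real)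
      then have "of_real u powr (of_nat d - s) * of_real h powr (s - of_nat i)
          = of_real (u ^ (d - i)) * of_real (h / u) powr (s - of_nat i)"
        using u h_pos that
        by (simp add: of_real_powr_exp ln_div of_nat_diff algebra_simps del: of_real_divide of_real_power flip: exp_add)
      then show ?thesis by (simp add: field_simps)
    qed
    have 2: "of_real u powr (of_nat d - s) * of_real (m x) powr (s - of_nat d)
        = of_real (u / m x) powr (of_nat d - s)" for x
      using u m_pos[of x]
      by (simp add: of_real_powr_exp ln_div algebra_simps del: of_real_divide flip: exp_add)
    have "of_real u powr (of_nat d - s) * ((\<integral>x. of_real (m x) powr (s - of_nat d) \<partial>M) / (of_nat d - s))
        = (\<integral>x. of_real (u / m x) powr (of_nat d - s) / (of_nat d - s) \<partial>M)"
      unfolding 2[symmetric] by (simp add: mult.assoc)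
    then show ?thesis
      unfolding i ds s_def[symmetric] bracket_eq[OF s] distrib_left sum_distrib_left
      by (intro arg_cong2[of _ _ _ _ "(+)"] sum.cong refl 1) simp_all
  qed
  have cont1: "continuous_on {-\<tau>..\<tau>} (\<lambda>t. of_real (h / u) powr Complex (c - real i) t / Complex (c - real i) t)"
    if "i < d" for i
    using u h_pos ci[OF that]
    by (auto intro!: continuous_intros Complex_nonzero simp: of_real_powr_exp simp del: of_real_divide)
  have int1: "(\<lambda>t. of_real (\<kappa> i * u ^ (d - i)) * (of_real (h / u) powr Complex (c - real i) t / Complex (c - real i) t))
      integrable_on {-\<tau>..\<tau>}" if "i < d" for i
    using integrable_on_mult_right[OF integrable_continuous_real[OF cont1[OF that]]] by simp
  have int2: "(\<lambda>t. \<integral>x. of_real (u / m x) powr Complex (real d - c) (- t) / Complex (real d - c) (- t) \<partial>M)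
      integrable_on {-\<tau>..\<tau>}"
    by (rule perron_m_swap(3)[OF u c(2)])
  have split: "integral {-\<tau>..\<tau>} (\<lambda>t. (\<Sum>i<d. v i t) + w t)
      = (\<Sum>i<d. integral {-\<tau>..\<tau>} (v i)) + integral {-\<tau>..\<tau>} w"
    if "\<And>i. i < d \<Longrightarrow> v i integrable_on {-\<tau>..\<tau>}" "w integrable_on {-\<tau>..\<tau>}"
    for v :: "nat \<Rightarrow> real \<Rightarrow> complex" and w
  proof -
    have "(\<lambda>t. \<Sum>i<d. v i t) integrable_on {-\<tau>..\<tau>}"
      by (rule Henstock_Kurzweil_Integration.integrable_sum) (use that in auto)
    moreover have "integral {-\<tau>..\<tau>} (\<lambda>t. \<Sum>i<d. v i t) = (\<Sum>i<d. integral {-\<tau>..\<tau>} (v i))"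
      by (rule Henstock_Kurzweil_Integration.integral_sum) (use that in auto)
    ultimately show ?thesis
      using Henstock_Kurzweil_Integration.integral_add[OF _ that(2), of "\<lambda>t. \<Sum>i<d. v i t"] by simp
  qed
  have "vertical c \<tau> u = (\<Sum>i<d. integral {-\<tau>..\<tau>} (\<lambda>t. of_real (\<kappa> i * u ^ (d - i)) * (of_real (h / u) powr Complex (c - real i) t / Complex (c - real i) t))) / (2 * pi)
     + integral {-\<tau>..\<tau>} (\<lambda>t. \<integral>x. of_real (u / m x) powr Complex (real d - c) (- t) / Complex (real d - c) (- t) \<partial>M) / (2 * pi)"
    unfolding vertical_def eq add_divide_distrib[symmetric] by (subst split[OF int1 int2]) simp_all
  then show ?thesis
    unfolding perron_m_swap(1)[OF u c(2)] Henstock_Kurzweil_Integration.integral_mult_right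
    by (simp only: perron_def sum_divide_distrib times_divide_eq_right)
qed

text \<open>The polynomial is given strictly below \<open>h\<close>. Continuity of the measure from
  below reaches the set \<delta> < h, and the null level set closes the gap. The value is needed at
  the jump \<open>u = h\<close> of the kernel.\<close>

lemma V_h: "V h = (\<Sum>i<d. \<kappa> i * h ^ (d - i))"
proof -
  \<comment> \<open>The shift by 2 keeps the radius positive already for
    \<open>n = 0\<close>.\<close>
  define A where "A n = {x \<in> space M. \<delta> x \<le> h * (1 - 1 / (real n + 2))}" for n
  have pos: "0 < h * (1 - 1 / (real n + 2))" "h * (1 - 1 / (real n + 2)) < h" for n
    using h_pos by (auto simp: field_simps add_pos_nonneg)
  have mono: "incseq A"
    unfolding incseq_def
  proof (intro allI impI)
    fix k n :: nat assume "k \<le> n"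
    then have "h * (1 - 1 / (real k + 2)) \<le> h * (1 - 1 / (real n + 2))"
      using h_pos by (intro mult_left_mono diff_left_mono divide_left_mono) auto
    then show "A k \<subseteq> A n" by (auto simp: A_def)
  qed
  have lim1: "(\<lambda>n. h * (1 - 1 / (real n + 2))) \<longlonglongrightarrow> h"
    by real_asymp
  have "(\<lambda>n. measure M (A n)) \<longlonglongrightarrow> measure M (\<Union>n. A n)"
    by (rule finite_Lim_measure_incseq[OF _ mono]) (auto simp: A_def)
  also have "(\<Union>n. A n) = {x \<in> space M. \<delta> x < h}"
  proof (intro set_eqI iffI)
    fix x assume x: "x \<in> {x \<in> space M. \<delta> x < h}"
    then have "eventually (\<lambda>n. \<delta> x < h * (1 - 1 / (real n + 2))) sequentially"
      using order_tendstoD(1)[OF lim1] by auto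
    then obtain n where "\<delta> x < h * (1 - 1 / (real n + 2))" by (auto simp: eventually_sequentially)
    then have "x \<in> A n" using x by (simp add: A_def)
    then show "x \<in> (\<Union>n. A n)" by blast
  next
    fix x assume "x \<in> (\<Union>n. A n)"
    then obtain n where "x \<in> A n" by blast
    then show "x \<in> {x \<in> space M. \<delta> x < h}" using pos(2)[of n] by (simp add: A_def)
  qed
  also have "measure M {x \<in> space M. \<delta> x < h} = V h"
  proof -
    have "V h = measure M ({x \<in> space M. \<delta> x < h} \<union> {x \<in> space M. \<delta> x = h})"
      unfolding V_def by (intro arg_cong[of _ _ "measure M"]) auto
    also have "\<dots> = measure M {x \<in> space M. \<delta> x < h}"
      using level_null[OF h_pos] by (subst finite_measure_Union) auto
    finally show ?thesis by simp
  qed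
  finally have "(\<lambda>n. \<Sum>i<d. \<kappa> i * (h * (1 - 1 / (real n + 2))) ^ (d - i)) \<longlonglongrightarrow> V h"
    using small[OF pos] by (simp add: A_def)
  moreover have "(\<lambda>n. \<Sum>i<d. \<kappa> i * (h * (1 - 1 / (real n + 2))) ^ (d - i)) \<longlonglongrightarrow> (\<Sum>i<d. \<kappa> i * h ^ (d - i))"
    by (intro tendsto_intros lim1)
  ultimately show ?thesis by (rule LIMSEQ_unique)
qed

text \<open>The polynomial terms tend to the fraction \<open>q\<close> of \<open>V u\<close> and the
  distance integral to the fraction \<open>1 - q\<close>: below \<open>h\<close> everything comes
  from the former, above \<open>h\<close> from the latter, and at \<open>h\<close> each gives
  half.\<close>

lemma vertical_tendsto:
  assumes u: "0 < u" and c: "real d - 1 < c" "c < real d"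
  shows "((\<lambda>\<tau>. vertical c \<tau> u) \<longlongrightarrow> of_real (V u)) at_top"
proof -
  define q :: real where "q = (if u < h then 1 else if u = h then 1/2 else 0)"
  have ci: "0 < c - real i" if "i < d" for i using that c by linarith
  have "((\<lambda>\<tau>. \<Sum>i<d. of_real (\<kappa> i * u ^ (d - i)) * perron \<tau> (h / u) (c - real i))
      \<longlongrightarrow> (\<Sum>i<d. of_real (\<kappa> i * u ^ (d - i)) * of_real q)) at_top"
  proof (intro tendsto_intros)
    fix i assume "i \<in> {..<d}"
    then have "((\<lambda>\<tau>. perron \<tau> (h / u) (c - real i)) \<longlongrightarrow>
        (if 1 < h / u then 1 else if h / u = 1 then 1/2 else 0)) at_top"
      using u h_pos ci by (intro perron_tendsto) auto
    then show "((\<lambda>\<tau>. perron \<tau> (h / u) (c - real i)) \<longlongrightarrow> of_real q) at_top"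
      using u by (rule_tac tendsto_eq_rhs) (auto simp: q_def)
  qed
  also have "(\<Sum>i<d. of_real (\<kappa> i * u ^ (d - i)) * of_real q) = complex_of_real (q * V u)"
    using small[of u] V_h u
    by (auto simp: q_def V_def sum_distrib_left mult.commute)
  finally have lim1: "((\<lambda>\<tau>. \<Sum>i<d. of_real (\<kappa> i * u ^ (d - i)) * perron \<tau> (h / u) (c - real i))
      \<longlongrightarrow> of_real (q * V u)) at_top" .
  define L :: "'b \<Rightarrow> complex" where
    "L x = (if 1 < u / m x then 1 else if u / m x = 1 then 1/2 else 0)" for x
  have "((\<lambda>\<tau>. \<integral>x. perron \<tau> (u / m x) (real d - c) \<partial>M) \<longlongrightarrow> (\<integral>x. L x \<partial>M)) at_top"
  proof (rule integral_dominated_convergence_at_top)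
    show "L \<in> borel_measurable M" unfolding L_def by measurable
    show "(\<lambda>x. perron \<tau> (u / m x) (real d - c)) \<in> borel_measurable M" for \<tau>
      using perron_m_swap(2)[OF u c(2)] by auto
    show "integrable M (\<lambda>x. 2 * (u / h) powr (real d - c))" by simp
    show "AE x in M. ((\<lambda>\<tau>. perron \<tau> (u / m x) (real d - c)) \<longlongrightarrow> L x) at_top"
      unfolding L_def using u m_pos c by (intro AE_I2 perron_tendsto) auto
    show "\<forall>\<^sub>F \<tau> in at_top. AE x in M. norm (perron \<tau> (u / m x) (real d - c)) \<le> 2 * (u / h) powr (real d - c)"
      using eventually_gt_at_top[of 0]
    proof eventually_elim
      case (elim \<tau>)
      show ?case
      proof (rule AE_I2)
        fix x
        have "norm (perron \<tau> (u / m x) (real d - c)) \<le> 2 * (u / m x) powr (real d - c)"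
          using u m_pos c elim by (intro perron_bound) auto
        also have "\<dots> \<le> 2 * (u / h) powr (real d - c)"
          using u m_pos[of x] h_le_m[of x] h_pos c by (intro mult_left_mono powr_mono2 divide_left_mono) auto
        finally show "norm (perron \<tau> (u / m x) (real d - c)) \<le> 2 * (u / h) powr (real d - c)" .
      qed
    qed
  qed
  \<comment> \<open>\<open>L\<close> is 1/2 where \<open>m x = u\<close>. For \<open>u > h\<close>
    this is the null level set \<delta> = u; for \<open>u = h\<close> it is the set \<delta> \<le>
    h, on which 1/2 is the wanted \<open>1 - q\<close>.\<close>
  also have "(\<integral>x. L x \<partial>M) = (\<integral>x. of_real (1 - q) * of_real (indicator {x \<in> space M. \<delta> x \<le> u} x) \<partial>M)"
  proof (rule integral_cong_AE)
    have "{x \<in> space M. \<delta> x = u} \<in> null_sets M"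
      using level_null[OF u] by (intro null_setsI) (auto simp: emeasure_eq_measure)
    then have "AE x in M. \<delta> x \<noteq> u"
      by (rule AE_mp[OF AE_not_in]) (auto intro: AE_I2)
    then have "AE x in M. x \<in> space M \<and> \<delta> x \<noteq> u" using AE_space by eventually_elim simp
    then show "AE x in M. L x = of_real (1 - q) * of_real (indicator {x \<in> space M. \<delta> x \<le> u} x)"
    proof eventually_elim
      case (elim x)
      have "L x = 1 - of_real q" if "\<delta> x < u"
        using that h_pos u by (auto simp: L_def q_def m_def divide_simps)
      moreover have "L x = 0" if "u < \<delta> x"
        using that h_pos u by (auto simp: L_def m_def divide_simps)
      ultimately show ?case using elim by (cases "\<delta> x" u rule: linorder_cases) (auto simp: indicator_def)
    qed
  qed (unfold L_def, measurable)
  also have "\<dots> = of_real (1 - q) * (\<integral>x. of_real (indicator {x \<in> space M. \<delta> x \<le> u} x) \<partial>M)"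
    by (rule integral_mult_right_zero)
  also have "(\<integral>x. of_real (indicator {x \<in> space M. \<delta> x \<le> u} x) \<partial>M)
      = complex_of_real (measure M ({x \<in> space M. \<delta> x \<le> u} \<inter> space M))"
    by (simp only: integral_complex_of_real Bochner_Integration.integral_indicator)
  also have "{x \<in> space M. \<delta> x \<le> u} \<inter> space M = {x \<in> space M. \<delta> x \<le> u}" by auto
  finally have lim2: "((\<lambda>\<tau>. \<integral>x. perron \<tau> (u / m x) (real d - c) \<partial>M) \<longlongrightarrow> of_real ((1 - q) * V u)) at_top"
    by (simp add: V_def)
  show ?thesis
    unfolding vertical_eq[OF u c]
    using tendsto_add[OF lim1 lim2] by (simp add: left_diff_distrib)
qed

text \<open>The Perron bounds all collapse to the one power \<open>u powr (real d - c)\<close>,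
  because \<open>u ^ (d - i) * (h / u) powr (c - real i)\<close> has the same exponent of
  \<open>u\<close> for every \<open>i\<close>. Uniformity in both \<tau> and \<open>u\<close> is
  what the sum over words requires.\<close>

lemma vertical_bound:
  assumes c: "real d - 1 < c" "c < real d"
  obtains K where "0 \<le> K" "\<And>\<tau> u. 0 < \<tau> \<Longrightarrow> 0 < u \<Longrightarrow> norm (vertical c \<tau> u) \<le> K * u powr (real d - c)"
proof
  let ?K = "(\<Sum>i<d. 2 * \<bar>\<kappa> i\<bar> * h powr (c - real i)) + 2 * measure M (space M) * h powr (- (real d - c))"
  show "0 \<le> ?K" by (intro add_nonneg_nonneg sum_nonneg mult_nonneg_nonneg) auto
  fix \<tau> u :: real assume \<tau>: "0 < \<tau>" and u: "0 < u"
  have ci: "0 < c - real i" if "i < d" for i using that c by linarith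
  have 1: "norm (\<Sum>i<d. of_real (\<kappa> i * u ^ (d - i)) * perron \<tau> (h / u) (c - real i))
      \<le> (\<Sum>i<d. (2 * \<bar>\<kappa> i\<bar> * h powr (c - real i)) * u powr (real d - c))"
  proof (rule sum_norm_le)
    fix i assume i: "i \<in> {..<d}"
    have "u ^ (d - i) = u powr (real d - real i)"
      using i u by (simp add: powr_realpow[symmetric] of_nat_diff)
    then have eq: "u ^ (d - i) * (h / u) powr (c - real i) = h powr (c - real i) * u powr (real d - c)"
      using u h_pos by (simp add: powr_divide powr_diff field_simps)
    have "norm (of_real (\<kappa> i * u ^ (d - i)) * perron \<tau> (h / u) (c - real i))
        = \<bar>\<kappa> i\<bar> * u ^ (d - i) * norm (perron \<tau> (h / u) (c - real i))"
      using u by (simp add: norm_mult abs_mult norm_power)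
    also have "\<dots> \<le> \<bar>\<kappa> i\<bar> * u ^ (d - i) * (2 * (h / u) powr (c - real i))"
      using u h_pos \<tau> ci i by (intro mult_left_mono perron_bound) auto
    also have "\<dots> = 2 * \<bar>\<kappa> i\<bar> * (u ^ (d - i) * (h / u) powr (c - real i))" by simp
    finally show "norm (of_real (\<kappa> i * u ^ (d - i)) * perron \<tau> (h / u) (c - real i))
        \<le> 2 * \<bar>\<kappa> i\<bar> * h powr (c - real i) * u powr (real d - c)"
      unfolding eq by simp
  qed
  have "norm (\<integral>x. perron \<tau> (u / m x) (real d - c) \<partial>M) \<le> (\<integral>x. 2 * (u / h) powr (real d - c) \<partial>M)"
  proof (rule norm_integral_le[OF perron_m_swap(2)[OF u c(2)]])
    fix x
    have "norm (perron \<tau> (u / m x) (real d - c)) \<le> 2 * (u / m x) powr (real d - c)"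
      using u m_pos c \<tau> by (intro perron_bound) auto
    also have "\<dots> \<le> 2 * (u / h) powr (real d - c)"
      using u m_pos[of x] h_le_m[of x] h_pos c by (intro mult_left_mono powr_mono2 divide_left_mono) auto
    finally show "norm (perron \<tau> (u / m x) (real d - c)) \<le> 2 * (u / h) powr (real d - c)" .
  qed simp
  also have "\<dots> = 2 * measure M (space M) * h powr (- (real d - c)) * u powr (real d - c)"
    using u h_pos by (simp add: powr_divide powr_minus_divide del: minus_diff_eq)
  finally have 2: "norm (\<integral>x. perron \<tau> (u / m x) (real d - c) \<partial>M)
      \<le> 2 * measure M (space M) * h powr (- (real d - c)) * u powr (real d - c)" .
  show "norm (vertical c \<tau> u) \<le> ?K * u powr (real d - c)"
    unfolding vertical_eq[OF u c] using norm_triangle_mono[OF 1 2]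
    by (simp add: sum_distrib_right[symmetric] ring_distribs[symmetric] del: minus_diff_eq)
qed

end

section \<open>Summing over words and residues\<close>

lemma norm_sum_powr_le:
  fixes r :: "nat \<Rightarrow> real"
  assumes "\<And>j. j \<in> {1..J} \<Longrightarrow> 0 < r j \<and> r j < 1"
  shows "norm (\<Sum>j=1..J. complex_of_real (r j) powr s) \<le> (\<Sum>j=1..J. r j powr Re s)"
  by (rule sum_norm_le) (use assms in \<open>auto simp: norm_powr_real_powr less_imp_le\<close>)

lemma sum_powr_less_1:
  fixes r :: "nat \<Rightarrow> real"
  assumes r: "\<And>j. j \<in> {1..J} \<Longrightarrow> 0 < r j \<and> r j < 1" and D: "(\<Sum>j=1..J. r j powr D) = 1" and "D < x"
  shows "(\<Sum>j=1..J. r j powr x) < 1"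
proof -
  have "{1..J} \<noteq> {}" using D by (metis sum.empty zero_neq_one)
  then have "(\<Sum>j=1..J. r j powr x) < (\<Sum>j=1..J. r j powr D)"
    by (intro sum_strict_mono) (use r \<open>D < x\<close> in \<open>auto simp: powr_less_mono'\<close>)
  then show ?thesis using D by simp
qed

section \<open>Complex dimensions as zeros of a Dirichlet polynomial\<close>

context
  fixes J :: nat and r :: "nat \<Rightarrow> real" and D :: real
  assumes r: "\<And>j. j \<in> {1..J} \<Longrightarrow> 0 < r j \<and> r j < 1" and D: "(\<Sum>j=1..J. r j powr D) = 1"
begin

lemma dirichlet_polynomial_nonzero:
  assumes "D < Re s"
  shows "1 - (\<Sum>j=1..J. complex_of_real (r j) powr s) \<noteq> 0"
proof
  assume "1 - (\<Sum>j=1..J. complex_of_real (r j) powr s) = 0"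
  then have "(\<Sum>j=1..J. complex_of_real (r j) powr s) = 1" by simp
  then show False
    using norm_sum_powr_le[of J r s] sum_powr_less_1[OF r D assms] r by simp
qed

lemma holomorphic_dirichlet_polynomial:
  "(\<lambda>s. 1 - (\<Sum>j=1..J. complex_of_real (r j) powr s)) holomorphic_on A"
  by (intro holomorphic_intros)

text \<open>The denominator is entire and nonzero at \<open>D + 1\<close>, so its zeros are isolated
  and its reciprocal tends to infinity at each of them.\<close>

lemma complex_dims_eq: "complex_dims J r = {s. 1 - (\<Sum>j=1..J. complex_of_real (r j) powr s) = 0}"
proof -
  define f where "f s = 1 - (\<Sum>j=1..J. complex_of_real (r j) powr s)" for s
  have hol: "f holomorphic_on UNIV" unfolding f_def by (rule holomorphic_dirichlet_polynomial)
  have zeta: "scaling_zeta J r = (\<lambda>s. 1 / f s)" by (auto simp: scaling_zeta_def f_def)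
  have cont: "isCont f s" for s
    using holomorphic_on_imp_continuous_on[OF hol] by (simp add: continuous_on_eq_continuous_at)
  have "is_pole (\<lambda>s. 1 / f s) s \<longleftrightarrow> f s = 0" for s
  proof
    assume pole: "is_pole (\<lambda>s. 1 / f s) s"
    show "f s = 0"
    proof (rule ccontr)
      assume "f s \<noteq> 0"
      then have "((\<lambda>s. 1 / f s) \<longlongrightarrow> 1 / f s) (at s)"
        using cont[of s] by (intro tendsto_intros) (auto simp: isCont_def)
      then show False
        using pole not_tendsto_and_filterlim_at_infinity[of "at s" "\<lambda>s. 1 / f s"]
        by (auto simp: is_pole_def)
    qed
  next
    assume 0: "f s = 0"
    obtain e where e: "0 < e" "\<And>z. z \<in> ball s e - {s} \<Longrightarrow> f z \<noteq> 0"
      using isolated_zeros[OF hol open_UNIV connected_UNIV UNIV_I 0 UNIV_I, of "of_real (D + 1)"]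
        dirichlet_polynomial_nonzero[of "of_real (D + 1)"] by (auto simp: f_def)
    have "filterlim f (at 0) (at s)"
      unfolding filterlim_at
    proof
      show "\<forall>\<^sub>F z in at s. f z \<in> UNIV \<and> f z \<noteq> 0"
        unfolding eventually_at using e by (intro exI[of _ e]) (auto simp: dist_commute)
      show "(f \<longlongrightarrow> 0) (at s)" using cont[of s] 0 by (simp add: isCont_def)
    qed
    then show "is_pole (\<lambda>s. 1 / f s) s"
      unfolding is_pole_def by (intro filterlim_divide_at_infinity[OF tendsto_const]) auto
  qed
  then show ?thesis by (simp add: complex_dims_def zeta f_def)
qed

lemma complex_dims_Re_le: "\<omega> \<in> complex_dims J r \<Longrightarrow> Re \<omega> \<le> D"
  using dirichlet_polynomial_nonzero[of \<omega>] unfolding complex_dims_eq by force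

text \<open>The zeros lie between a left half plane in which the polynomial is bounded away from 0
  and the line through \<open>D\<close>; a bound on the imaginary part confines them to a compact
  rectangle.\<close>

lemma finite_tiling_dims: "finite {\<omega> \<in> tiling_dims J r d. \<bar>Im \<omega>\<bar> \<le> T}"
proof -
  define f where "f s = 1 - (\<Sum>j=1..J. complex_of_real (r j) powr s)" for s
  have "1 \<le> J" using D by (cases J) auto
  then obtain a where a: "\<And>s. Re s \<le> a \<Longrightarrow> 1/2 \<le> norm (f s)"
    using dirichlet_polynomial_lower_bound_left[of J r] r unfolding f_def by metis
  have hol: "f holomorphic_on UNIV" unfolding f_def by (rule holomorphic_dirichlet_polynomial)
  have zeros: "complex_dims J r = {s. f s = 0}" by (simp add: complex_dims_eq f_def)
  have "\<not> f constant_on UNIV"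
  proof
    assume "f constant_on UNIV"
    then have "f (of_real D) = f (of_real (D + 1))" by (metis constant_on_def UNIV_I)
    moreover have "f (of_real D) = 0"
    proof -
      have "(\<Sum>j=1..J. complex_of_real (r j) powr of_real D) = of_real (\<Sum>j=1..J. r j powr D)"
        unfolding of_real_sum by (intro sum.cong refl powr_of_real) (use r in \<open>auto simp: less_imp_le\<close>)
      also have "\<dots> = 1" by (simp only: D of_real_1)
      finally show ?thesis by (simp add: f_def)
    qed
    ultimately show False using dirichlet_polynomial_nonzero[of "of_real (D + 1)"] by (simp add: f_def)
  qed
  then have "finite {z \<in> cbox (Complex a (- T)) (Complex D T). f z = 0}"
    by (intro holomorphic_compact_finite_zeros[OF hol]) auto
  moreover have "{\<omega> \<in> complex_dims J r. \<bar>Im \<omega>\<bar> \<le> T} \<subseteq> {z \<in> cbox (Complex a (- T)) (Complex D T). f z = 0}"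
  proof
    fix \<omega> assume \<omega>: "\<omega> \<in> {\<omega> \<in> complex_dims J r. \<bar>Im \<omega>\<bar> \<le> T}"
    then have "f \<omega> = 0" by (simp add: zeros)
    then have "a \<le> Re \<omega>" using a[of \<omega>] by force
    then show "\<omega> \<in> {z \<in> cbox (Complex a (- T)) (Complex D T). f z = 0}"
      using \<omega> \<open>f \<omega> = 0\<close> complex_dims_Re_le[of \<omega>] by (auto simp: in_cbox_complex_iff)
  qed
  ultimately have "finite {\<omega> \<in> complex_dims J r. \<bar>Im \<omega>\<bar> \<le> T}" by (rule finite_subset[rotated])
  moreover have "{\<omega> \<in> tiling_dims J r d. \<bar>Im \<omega>\<bar> \<le> T} \<subseteq> {\<omega> \<in> complex_dims J r. \<bar>Im \<omega>\<bar> \<le> T} \<union> of_nat ` {..<d}"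
    by (auto simp: tiling_dims_def)
  ultimately show ?thesis by (meson finite_subset finite_UnI finite_imageI finite_lessThan)
qed

end

lemma sum_word_ratio_powr:
  assumes r: "\<And>j. j \<in> {1..J} \<Longrightarrow> 0 < r j"
  shows "(\<Sum>w\<in>words J k. word_ratio r w powr x) = (\<Sum>j=1..J. r j powr x) ^ k"
proof -
  have w: "complex_of_real (word_ratio r w) powr of_real x = of_real (word_ratio r w powr x)"
    if "w \<in> words J k" for w
    using word_ratio_pos[of J r w] r that by (intro powr_of_real) (auto simp: words_def less_imp_le)
  have j: "complex_of_real (r j) powr of_real x = of_real (r j powr x)" if "j \<in> {1..J}" for j
    using r[OF that] by (intro powr_of_real) auto
  have "complex_of_real (\<Sum>w\<in>words J k. word_ratio r w powr x) = (\<Sum>w\<in>words J k. of_real (word_ratio r w) powr of_real x)"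
    unfolding of_real_sum by (intro sum.cong refl w[symmetric])
  also have "\<dots> = (\<Sum>j=1..J. of_real (r j) powr of_real x) ^ k"
    by (rule sum_words_powr[OF r])
  also have "\<dots> = complex_of_real ((\<Sum>j=1..J. r j powr x) ^ k)"
    unfolding of_real_power of_real_sum by (intro arg_cong[of _ _ "\<lambda>y. y ^ k"] sum.cong refl j)
  finally show ?thesis unfolding of_real_eq_iff .
qed

text \<open>A term \<open>\<rho> powr s\<close> of the scaling zeta function amounts to passing to a
  copy scaled by \<rho>, with volume factor \<open>\<rho> ^ d\<close> and width
  \<open>\<epsilon> / \<rho>\<close>.\<close>

lemma of_real_powr_scale:
  fixes s :: complex
  assumes "0 < \<rho>" "0 < \<epsilon>"
  shows "of_real \<rho> powr s * of_real \<epsilon> powr (of_nat d - s) = of_real (\<rho> ^ d) * of_real (\<epsilon> / \<rho>) powr (of_nat d - s)"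
proof -
  have "of_real (\<rho> ^ d) = exp (of_nat d * complex_of_real (ln \<rho>))"
    using assms by (simp add: exp_of_nat_mult exp_of_real)
  then show ?thesis
    using assms by (simp add: of_real_powr_exp ln_div algebra_simps del: of_real_divide of_real_power flip: exp_add)
qed

section \<open>From word sums to sums of residues\<close>

context inner_tube
begin

lemma continuous_on_bracket_line:
  assumes c: "real d - 1 < c" "c < real d"
  shows "continuous_on S (\<lambda>t. bracket (Complex c t))"
proof (rule continuous_on_compose2[OF holomorphic_on_imp_continuous_on[OF holomorphic_bracket]])
  have "Complex c t \<noteq> of_nat i" if "i \<le> d" for t i
  proof
    assume "Complex c t = of_nat i"
    then have "c = real i" by (simp add: complex_eq_iff)
    then show False using that c by (cases "i = d") auto
  qed
  then show "Complex c ` S \<subseteq> UNIV - of_nat ` {..d}" by auto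
qed (intro continuous_intros)

text \<open>On the line through \<open>c\<close> the geometric series of the scaling zeta function
  has a ratio below 1 uniformly in the height. On a bounded segment the other factor is bounded, so
  the M-test permits integration term by term.\<close>

lemma vertical_line_sums:
  assumes r: "\<And>j. j \<in> {1..J} \<Longrightarrow> 0 < r j \<and> r j < 1" and c: "real d - 1 < c" "c < real d"
    and \<rho>: "(\<Sum>j=1..J. r j powr c) < 1" and \<epsilon>: "0 < \<epsilon>"
  shows "(\<lambda>k. \<Sum>w\<in>words J k. of_real (word_ratio r w ^ d) * vertical c \<tau> (\<epsilon> / word_ratio r w)) sums
    (integral {-\<tau>..\<tau>} (\<lambda>t. scaling_zeta J r (Complex c t) * of_real \<epsilon> powr (of_nat d - Complex c t)
      * bracket (Complex c t)) / (2 * pi))"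
proof -
  define z where "z t = (\<Sum>j=1..J. complex_of_real (r j) powr Complex c t)" for t
  define b where "b t = of_real \<epsilon> powr (of_nat d - Complex c t) * bracket (Complex c t)" for t
  have zb: "norm (z t) \<le> (\<Sum>j=1..J. r j powr c)" for t
    unfolding z_def using norm_sum_powr_le[of J r "Complex c t"] r by simp
  have cont_powr: "continuous_on S (\<lambda>t. of_real y powr Complex c t)"
    "continuous_on S (\<lambda>t. of_real y powr (of_nat d - Complex c t))" if "0 < y" for y :: real and S
    unfolding of_real_powr_exp[OF that] by (intro continuous_intros)+
  have cont_z: "continuous_on S z" for S
    unfolding z_def by (intro continuous_on_sum cont_powr) (use r in auto)
  have cont_b: "continuous_on S b" for S
    unfolding b_def by (intro continuous_on_mult cont_powr \<epsilon> continuous_on_bracket_line c)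
  have "bounded (b ` {-\<tau>..\<tau>})"
    using cont_b by (intro compact_imp_bounded compact_continuous_image) auto
  then obtain B where B: "\<And>t. t \<in> {-\<tau>..\<tau>} \<Longrightarrow> norm (b t) \<le> B"
    unfolding bounded_iff by blast
  have "uniform_limit {-\<tau>..\<tau>} (\<lambda>n t. \<Sum>k<n. z t ^ k * b t) (\<lambda>t. \<Sum>k. z t ^ k * b t) sequentially"
  proof (rule Weierstrass_m_test)
    show "summable (\<lambda>k. (\<Sum>j=1..J. r j powr c) ^ k * B)"
      using \<rho> sum_nonneg[of "{1..J}" "\<lambda>j. r j powr c"] by (intro summable_mult2 summable_geometric) auto
    fix k t assume "t \<in> {-\<tau>..\<tau>}"
    then show "norm (z t ^ k * b t) \<le> (\<Sum>j=1..J. r j powr c) ^ k * B"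
      unfolding norm_mult norm_power using B zb by (intro mult_mono power_mono zero_le_power sum_nonneg) auto
  qed
  then obtain I K where I: "\<And>n. ((\<lambda>t. \<Sum>k<n. z t ^ k * b t) has_integral I n) {-\<tau>..\<tau>}"
    and K: "((\<lambda>t. \<Sum>k. z t ^ k * b t) has_integral K) {-\<tau>..\<tau>}" and lim: "I \<longlonglongrightarrow> K"
    by (rule uniform_limit_integral) (auto intro!: continuous_intros cont_z cont_b)
  have zeta: "(\<Sum>k. z t ^ k * b t) = scaling_zeta J r (Complex c t) * of_real \<epsilon> powr (of_nat d - Complex c t)
      * bracket (Complex c t)" for t
  proof -
    have "norm (z t) < 1" using zb[of t] \<rho> by linarith
    then have "(\<lambda>k. z t ^ k) sums (1 / (1 - z t))" by (rule geometric_sums)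
    then have "(\<lambda>k. z t ^ k * b t) sums (1 / (1 - z t) * b t)" by (rule sums_mult2)
    then show ?thesis by (simp add: sums_iff scaling_zeta_def z_def b_def mult.assoc)
  qed
  have int_zb: "(\<lambda>t. z t ^ k * b t) integrable_on {-\<tau>..\<tau>}" for k
    by (intro integrable_continuous_real continuous_intros cont_z cont_b)
  have summand: "integral {-\<tau>..\<tau>} (\<lambda>t. z t ^ k * b t) / (2 * pi)
      = (\<Sum>w\<in>words J k. of_real (word_ratio r w ^ d) * vertical c \<tau> (\<epsilon> / word_ratio r w))" for k
  proof -
    have pos: "0 < word_ratio r w" if "w \<in> words J k" for w
      using word_ratio_pos[of J r w] r that by (auto simp: words_def)
    define v where "v w t = of_real (\<epsilon> / word_ratio r w) powr (of_nat d - Complex c t) * bracket (Complex c t)" for w t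
    have "z t ^ k * b t = (\<Sum>w\<in>words J k. of_real (word_ratio r w ^ d) * v w t)" for t
    proof -
      have "z t ^ k = (\<Sum>w\<in>words J k. of_real (word_ratio r w) powr Complex c t)"
        unfolding z_def using sum_words_powr[of J r, where k = k and s = "Complex c t"] r by simp
      then have "z t ^ k * b t = (\<Sum>w\<in>words J k. of_real (word_ratio r w) powr Complex c t * b t)"
        by (simp only: sum_distrib_right)
      also have "\<dots> = (\<Sum>w\<in>words J k. of_real (word_ratio r w ^ d) * v w t)"
      proof (rule sum.cong[OF refl])
        fix w assume w: "w \<in> words J k"
        show "of_real (word_ratio r w) powr Complex c t * b t = of_real (word_ratio r w ^ d) * v w t"
          unfolding b_def v_def mult.assoc[symmetric] of_real_powr_scale[OF pos[OF w] \<epsilon>] ..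
      qed
      finally show ?thesis .
    qed
    moreover have "v w integrable_on {-\<tau>..\<tau>}" if "w \<in> words J k" for w
      unfolding v_def using pos[OF that] \<epsilon>
      by (intro integrable_continuous_real continuous_on_mult cont_powr continuous_on_bracket_line c) auto
    then have "integral {-\<tau>..\<tau>} (\<lambda>t. \<Sum>w\<in>words J k. of_real (word_ratio r w ^ d) * v w t)
        = (\<Sum>w\<in>words J k. of_real (word_ratio r w ^ d) * integral {-\<tau>..\<tau>} (v w))"
      by (subst Henstock_Kurzweil_Integration.integral_sum) (auto intro!: finite_words sum.cong integrable_on_mult_right simp del: of_real_power)
    ultimately show ?thesis
      by (simp add: vertical_def v_def[abs_def] sum_divide_distrib)
  qed
  have "(\<lambda>n. \<Sum>k<n. integral {-\<tau>..\<tau>} (\<lambda>t. z t ^ k * b t)) \<longlonglongrightarrow> K"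
  proof -
    have "I n = (\<Sum>k<n. integral {-\<tau>..\<tau>} (\<lambda>t. z t ^ k * b t))" for n
      using integral_unique[OF I[of n]] int_zb by (simp add: Henstock_Kurzweil_Integration.integral_sum)
    then have "I = (\<lambda>n. \<Sum>k<n. integral {-\<tau>..\<tau>} (\<lambda>t. z t ^ k * b t))" by (rule ext)
    then show ?thesis using lim by (simp only:)
  qed
  then have "(\<lambda>k. integral {-\<tau>..\<tau>} (\<lambda>t. z t ^ k * b t)) sums K" by (simp add: sums_def)
  then have "(\<lambda>k. integral {-\<tau>..\<tau>} (\<lambda>t. z t ^ k * b t) / (2 * pi)) sums (K / (2 * pi))"
    by (rule sums_divide)
  then show ?thesis
    unfolding summand using integral_unique[OF K] by (simp add: zeta)
qed

text \<open>Tannery's theorem exchanges the limit in \<tau> with the sum over word lengths. In the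
  bound for one word the factor \<open>word_ratio r w ^ d\<close> leaves
  \<open>word_ratio r w powr c\<close>, so the majorants form a geometric series.\<close>

lemma vertical_line_tendsto:
  assumes r: "\<And>j. j \<in> {1..J} \<Longrightarrow> 0 < r j \<and> r j < 1" and c: "real d - 1 < c" "c < real d"
    and \<rho>: "(\<Sum>j=1..J. r j powr c) < 1" and \<epsilon>: "0 < \<epsilon>"
  shows "((\<lambda>\<tau>. integral {-\<tau>..\<tau>} (\<lambda>t. scaling_zeta J r (Complex c t) * of_real \<epsilon> powr (of_nat d - Complex c t)
      * bracket (Complex c t)) / (2 * pi))
    \<longlongrightarrow> of_real (\<Sum>k. \<Sum>w\<in>words J k. word_ratio r w ^ d * V (\<epsilon> / word_ratio r w))) at_top"
proof -
  obtain K where K: "0 \<le> K" "\<And>\<tau> u. 0 < \<tau> \<Longrightarrow> 0 < u \<Longrightarrow> norm (vertical c \<tau> u) \<le> K * u powr (real d - c)"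
    using vertical_bound[OF c] by blast
  have pos: "0 < word_ratio r w" if "w \<in> words J k" for w k
    using word_ratio_pos[of J r w] r that by (auto simp: words_def)
  define a where "a k \<tau> = (\<Sum>w\<in>words J k. of_real (word_ratio r w ^ d) * vertical c \<tau> (\<epsilon> / word_ratio r w))" for k \<tau>
  define b where "b k = (\<Sum>w\<in>words J k. word_ratio r w ^ d * V (\<epsilon> / word_ratio r w))" for k
  have lim: "((\<lambda>\<tau>. a k \<tau>) \<longlongrightarrow> of_real (b k)) at_top" for k
    unfolding a_def b_def of_real_sum of_real_mult
    by (intro tendsto_intros vertical_tendsto c divide_pos_pos \<epsilon> pos)
  have bound: "norm (a k \<tau>) \<le> K * \<epsilon> powr (real d - c) * (\<Sum>j=1..J. r j powr c) ^ k" if "0 < \<tau>" for k \<tau>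
  proof -
    have "norm (a k \<tau>) \<le> (\<Sum>w\<in>words J k. K * \<epsilon> powr (real d - c) * word_ratio r w powr c)"
      unfolding a_def
    proof (rule sum_norm_le)
      fix w assume w: "w \<in> words J k"
      have "norm (of_real (word_ratio r w ^ d) * vertical c \<tau> (\<epsilon> / word_ratio r w))
          \<le> word_ratio r w ^ d * (K * (\<epsilon> / word_ratio r w) powr (real d - c))"
        using K(2)[OF that, of "\<epsilon> / word_ratio r w"] pos[OF w] \<epsilon>
        by (simp add: norm_mult norm_power mult_left_mono)
      also have "\<dots> = K * \<epsilon> powr (real d - c) * word_ratio r w powr c"
        using pos[OF w] \<epsilon> by (simp add: powr_divide powr_diff powr_realpow)
      finally show "norm (of_real (word_ratio r w ^ d) * vertical c \<tau> (\<epsilon> / word_ratio r w))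
          \<le> K * \<epsilon> powr (real d - c) * word_ratio r w powr c" .
    qed
    also have "\<dots> = K * \<epsilon> powr (real d - c) * (\<Sum>j=1..J. r j powr c) ^ k"
      using sum_word_ratio_powr[of J r c k] r by (simp add: sum_distrib_left[symmetric])
    finally show ?thesis .
  qed
  have "summable (\<lambda>k. K * \<epsilon> powr (real d - c) * (\<Sum>j=1..J. r j powr c) ^ k)"
    using \<rho> sum_nonneg[of "{1..J}" "\<lambda>j. r j powr c"] by (intro summable_mult summable_geometric) auto
  moreover have "eventually (\<lambda>(k, \<tau>). norm (a k \<tau>) \<le> K * \<epsilon> powr (real d - c) * (\<Sum>j=1..J. r j powr c) ^ k)
      (at_top \<times>\<^sub>F at_top)"
    using eventually_prodI[OF always_eventually eventually_gt_at_top[of "0::real"], of "\<lambda>_. True"]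
    by (rule eventually_mono) (use bound in auto)
  ultimately have tann: "summable (\<lambda>k. norm (complex_of_real (b k)))"
    "((\<lambda>\<tau>. \<Sum>k. a k \<tau>) \<longlongrightarrow> (\<Sum>k. complex_of_real (b k))) at_top"
    using tannerys_theorem[of a "\<lambda>k. of_real (b k)" at_top "\<lambda>k. K * \<epsilon> powr (real d - c) * (\<Sum>j=1..J. r j powr c) ^ k"]
      lim by auto
  have "summable (\<lambda>k. complex_of_real (b k))" using tann(1) by (rule summable_norm_cancel)
  then have "(\<Sum>k. complex_of_real (b k)) = of_real (\<Sum>k. b k)"
    by (simp add: summable_of_real_iff suminf_of_real)
  moreover have "(\<Sum>k. a k \<tau>) = integral {-\<tau>..\<tau>} (\<lambda>t. scaling_zeta J r (Complex c t)
      * of_real \<epsilon> powr (of_nat d - Complex c t) * bracket (Complex c t)) / (2 * pi)" for \<tau>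
    using vertical_line_sums[OF r c \<rho> \<epsilon>, of \<tau>] unfolding a_def by (simp add: sums_iff)
  ultimately show ?thesis using tann(2) by (simp add: b_def)
qed

text \<open>The heights are obtained from the scaling zeta function before \<epsilon> is fixed, so
  one sequence serves every \<epsilon>. On the horizontal edges the bracket supplies a factor
  \<open>1 / \<tau> n\<close>, which makes the contour error \<open>B / \<tau> n\<close>
  vanish.\<close>

theorem residue_sum_tendsto:
  assumes r: "\<And>j. j \<in> {1..J} \<Longrightarrow> 0 < r j \<and> r j < 1" and D: "(\<Sum>j=1..J. r j powr D) = 1"
    and Dd: "real d - 1 < D" "D < real d"
  obtains \<tau> :: "nat \<Rightarrow> real" where "\<And>n. real n \<le> \<tau> n \<and> \<tau> n \<le> real n + 1"
    "\<And>\<epsilon>. 0 < \<epsilon> \<Longrightarrow> \<epsilon> < h \<Longrightarrow>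
      (\<lambda>n. \<Sum>\<omega> | \<omega> \<in> tiling_dims J r d \<and> \<bar>Im \<omega>\<bar> \<le> \<tau> n.
        residue (\<lambda>s. scaling_zeta J r s * of_real \<epsilon> powr (of_nat d - s) * bracket s) \<omega>)
      \<longlonglongrightarrow> of_real (\<Sum>k. \<Sum>w\<in>words J k. word_ratio r w ^ d * V (\<epsilon> / word_ratio r w))"
proof -
  define f where "f s = 1 - (\<Sum>j=1..J. complex_of_real (r j) powr s)" for s
  have zeta: "scaling_zeta J r s = 1 / f s" for s by (simp add: scaling_zeta_def f_def)
  have zeros: "complex_dims J r = {s. f s = 0}" unfolding f_def by (rule complex_dims_eq[OF r D])
  have Re_le: "Re p \<le> D" if "p \<in> complex_dims J r" for p by (rule complex_dims_Re_le[OF r D that])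
  define c where "c = (D + real d) / 2"
  have c: "D < c" "real d - 1 < c" "c < real d" using Dd by (auto simp: c_def)
  have \<rho>: "(\<Sum>j=1..J. r j powr c) < 1" by (rule sum_powr_less_1[OF r D c(1)])
  have "1 \<le> J" using D by (cases J) auto
  then obtain a0 where a0: "\<And>s. Re s \<le> a0 \<Longrightarrow> 1/2 \<le> norm (f s)"
    using dirichlet_polynomial_lower_bound_left[of J r] r unfolding f_def by metis
  \<comment> \<open>The compactness argument needs a strip of bounded width; left of it the half
    plane estimate takes over. The minimum keeps the left end of the strip at most
    \<open>c\<close>.\<close>
  obtain \<eta> \<tau> where \<eta>: "0 < \<eta>" and \<tau>: "\<And>n. real n \<le> \<tau> n \<and> \<tau> n \<le> real n + 1"
    and line: "\<And>n s. min a0 c \<le> Re s \<Longrightarrow> Re s \<le> c \<Longrightarrow> \<bar>Im s\<bar> = \<tau> n \<Longrightarrow> \<eta> \<le> norm (f s)"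
    using dirichlet_polynomial_horizontal_lines[of J r c "min a0 c"] r \<rho> unfolding f_def by auto
  define \<theta> where "\<theta> = min \<eta> (1/2)"
  have \<theta>: "0 < \<theta>" using \<eta> by (simp add: \<theta>_def)
  have zeta_line: "norm (scaling_zeta J r s) \<le> 1 / \<theta>" if "Re s \<le> c" "\<bar>Im s\<bar> = \<tau> n" for s n
  proof -
    have "\<theta> \<le> norm (f s)"
      using line[of s n] a0[of s] that by (cases "Re s \<le> a0") (auto simp: \<theta>_def)
    then show ?thesis using \<theta> by (simp add: zeta norm_divide frac_le)
  qed
  have zeta_left: "norm (scaling_zeta J r s) \<le> 1 / \<theta>" if "Re s \<le> a0" for s
  proof -
    have "\<theta> \<le> norm (f s)" using a0[OF that] by (simp add: \<theta>_def)
    then show ?thesis using \<theta> by (simp add: zeta norm_divide frac_le)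
  qed
  obtain K where K: "0 \<le> K" "\<And>s \<rho>. Re s \<le> real d \<Longrightarrow> 0 < \<rho> \<Longrightarrow> (\<And>i. i \<le> d \<Longrightarrow> \<rho> \<le> norm (s - of_nat i)) \<Longrightarrow>
    norm (bracket s) \<le> K / \<rho> * h powr Re s"
    using bracket_bound by blast
  show thesis
  proof (rule that[of \<tau>, OF \<tau>])
    fix \<epsilon> assume \<epsilon>: "0 < \<epsilon>" "\<epsilon> < h"
    define F where "F s = scaling_zeta J r s * of_real \<epsilon> powr (of_nat d - s) * bracket s" for s
    define q where "q = h / \<epsilon>"
    have q: "1 < q" using \<epsilon> by (simp add: q_def)
    have F_bound: "norm (F s) \<le> (\<epsilon> powr real d * K / \<theta> / \<rho>) * q powr Re s"
      if "norm (scaling_zeta J r s) \<le> 1 / \<theta>" "Re s \<le> real d" "0 < \<rho>" "\<And>i. i \<le> d \<Longrightarrow> \<rho> \<le> norm (s - of_nat i)" for s \<rho>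
    proof -
      have "norm (F s) = norm (scaling_zeta J r s) * \<epsilon> powr (real d - Re s) * norm (bracket s)"
        using \<epsilon> by (simp add: F_def norm_mult norm_powr_real_powr)
      also have "\<dots> \<le> 1 / \<theta> * \<epsilon> powr (real d - Re s) * (K / \<rho> * h powr Re s)"
        by (intro mult_mono that K(2)) (use \<theta> in auto)
      also have "\<dots> = (\<epsilon> powr real d * K / \<theta> / \<rho>) * q powr Re s"
        using \<epsilon> h_pos by (simp add: q_def powr_diff powr_divide mult_ac)
      finally show ?thesis .
    qed
    define R where "R n = (\<Sum>\<omega> | \<omega> \<in> tiling_dims J r d \<and> \<bar>Im \<omega>\<bar> \<le> \<tau> n. residue F \<omega>)" for n
    define W where "W t = integral {-t..t} (\<lambda>x. F (Complex c x)) / (2 * pi)" for t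
    define B where "B = \<epsilon> powr real d * K / \<theta> * q powr c / (pi * ln q)"
    \<comment> \<open>The restriction to \<open>1 \<le> n\<close> excludes a vanishing
      height.\<close>
    have diff: "norm (R n - W (\<tau> n)) \<le> B / \<tau> n" if n: "1 \<le> n" for n
    proof -
      let ?Z = "\<lambda>T. {\<omega> \<in> tiling_dims J r d. \<bar>Im \<omega>\<bar> \<le> T}"
      have \<tau>n: "0 < \<tau> n" using \<tau>[of n] n by linarith
      have fin: "finite (?Z T)" for T by (rule finite_tiling_dims[OF r D])
      \<comment> \<open>Finitely many points of \<open>tiling_dims\<close> lie just above the
        cut-off, so the strip can be widened to \<tau>' without meeting a further
        singularity.\<close>
      define \<tau>' where "\<tau>' = Min (insert (\<tau> n + 1) ((\<lambda>\<omega>. \<bar>Im \<omega>\<bar>) ` (?Z (\<tau> n + 1) - ?Z (\<tau> n))))"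
      have \<tau>': "\<tau> n < \<tau>'" "\<tau>' \<le> \<tau> n + 1"
        unfolding \<tau>'_def using fin by (auto simp: finite_Diff)
      have gap: "\<omega> \<in> ?Z (\<tau> n)" if "\<omega> \<in> tiling_dims J r d" "\<bar>Im \<omega>\<bar> < \<tau>'" for \<omega>
      proof (rule ccontr)
        assume "\<omega> \<notin> ?Z (\<tau> n)"
        then have "\<omega> \<in> ?Z (\<tau> n + 1) - ?Z (\<tau> n)" using that \<tau>' by auto
        then have "\<tau>' \<le> \<bar>Im \<omega>\<bar>"
          unfolding \<tau>'_def using fin by (intro Min_le) (auto simp: finite_Diff)
        then show False using that by linarith
      qed
      have "norm (sum (residue F) (?Z (\<tau> n)) - integral {-\<tau> n..\<tau> n} (\<lambda>x. F (Complex c x)) / (2 * pi))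
          \<le> (\<epsilon> powr real d * K / \<theta> / \<tau> n) * q powr c / (pi * ln q)"
      \<comment> \<open>The region ends at Re s = d, so the singularity of the bracket there stays
        outside. For Re s at most -1 every i \<ge> 0 is at distance at least 1, whence the
        denominator 1 in \<open>M'\<close>.\<close>
      proof (rule contour_shift_left[OF fin _ c(3) \<tau>n \<tau>'(1) q, where M' = "\<epsilon> powr real d * K / \<theta> / 1" and ?N1.0 = "min a0 (-1)"])
        show "Re p < c \<and> \<bar>Im p\<bar> < \<tau> n" if p: "p \<in> ?Z (\<tau> n)" for p
        proof (cases "p \<in> complex_dims J r")
          case True
          then have "Re p < c" using Re_le[OF True] c by linarith
          moreover have "\<bar>Im p\<bar> \<noteq> \<tau> n"
          proof
            assume "\<bar>Im p\<bar> = \<tau> n"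
            then have "\<theta> \<le> norm (f p)"
              using line[of p n] a0[of p] \<open>Re p < c\<close> by (cases "Re p \<le> a0") (auto simp: \<theta>_def)
            then show False using True \<theta> by (simp add: zeros)
          qed
          ultimately show ?thesis using p by auto
        next
          case False
          then obtain i where "i < d" "p = of_nat i" using p by (auto simp: tiling_dims_def)
          then show ?thesis using \<tau>n c(2) by auto
        qed
        show "F holomorphic_on {s. Re s < real d \<and> \<bar>Im s\<bar> < \<tau>'} - ?Z (\<tau> n)"
        proof -
          let ?A = "{s. Re s < real d \<and> \<bar>Im s\<bar> < \<tau>'} - ?Z (\<tau> n)"
          have nd: "s \<notin> tiling_dims J r d" if "s \<in> ?A" for s using gap that by auto
          have "bracket holomorphic_on ?A"
          proof (rule holomorphic_on_subset[OF holomorphic_bracket])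
            have "s \<noteq> of_nat i" if "s \<in> ?A" "i \<le> d" for s i
              using nd[OF that(1)] that by (cases "i = d") (auto simp: tiling_dims_def)
            then show "?A \<subseteq> UNIV - of_nat ` {..d}" by blast
          qed
          moreover have "scaling_zeta J r holomorphic_on ?A"
          proof -
            have "f s \<noteq> 0" if "s \<in> ?A" for s using nd[OF that] zeros by (auto simp: tiling_dims_def)
            then have "(\<lambda>s. 1 / f s) holomorphic_on ?A"
              by (intro holomorphic_intros) (auto simp: f_def intro!: holomorphic_intros)
            then show ?thesis by (simp add: zeta[abs_def])
          qed
          ultimately show ?thesis
            unfolding F_def using \<epsilon> by (intro holomorphic_intros) auto
        qed
        show "norm (F s) \<le> (\<epsilon> powr real d * K / \<theta> / \<tau> n) * q powr Re s" if "Re s \<le> c" "\<bar>Im s\<bar> = \<tau> n" for s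
        proof (rule F_bound[OF zeta_line[OF that] _ \<tau>n])
          show "\<tau> n \<le> norm (s - of_nat i)" for i
            using abs_Im_le_cmod[of "s - of_nat i"] that by simp
        qed (use that c in linarith)
        show "norm (F s) \<le> (\<epsilon> powr real d * K / \<theta> / 1) * q powr Re s" if "Re s \<le> min a0 (-1)" for s
        proof (rule F_bound[OF zeta_left])
          show "1 \<le> norm (s - of_nat i)" for i
            using abs_Re_le_cmod[of "s - of_nat i"] that by simp
        qed (use that in auto)
      qed
      then show ?thesis
        by (simp add: R_def W_def B_def mult_ac)
    qed
    have \<tau>_lim: "filterlim \<tau> at_top sequentially"
      by (rule filterlim_at_top_mono[OF filterlim_real_sequentially]) (use \<tau> in auto)
    have "(\<lambda>n. R n - W (\<tau> n)) \<longlonglongrightarrow> 0"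
    proof (rule Lim_null_comparison)
      show "eventually (\<lambda>n. norm (R n - W (\<tau> n)) \<le> B / \<tau> n) sequentially"
        using eventually_ge_at_top[of 1] by eventually_elim (rule diff)
      show "(\<lambda>n. B / \<tau> n) \<longlonglongrightarrow> 0"
        by (rule tendsto_divide_0[OF tendsto_const filterlim_at_top_imp_at_infinity[OF \<tau>_lim]])
    qed
    moreover have "(\<lambda>n. W (\<tau> n)) \<longlonglongrightarrow> of_real (\<Sum>k. \<Sum>w\<in>words J k. word_ratio r w ^ d * V (\<epsilon> / word_ratio r w))"
      unfolding W_def F_def
      by (rule filterlim_compose[OF vertical_line_tendsto[OF r c(2,3) \<rho> \<epsilon>(1)] \<tau>_lim])
    ultimately have "R \<longlonglongrightarrow> of_real (\<Sum>k. \<Sum>w\<in>words J k. word_ratio r w ^ d * V (\<epsilon> / word_ratio r w))"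
      using tendsto_add by fastforce
    then show "(\<lambda>n. \<Sum>\<omega> | \<omega> \<in> tiling_dims J r d \<and> \<bar>Im \<omega>\<bar> \<le> \<tau> n.
        residue (\<lambda>s. scaling_zeta J r s * of_real \<epsilon> powr (of_nat d - s) * bracket s) \<omega>)
      \<longlonglongrightarrow> of_real (\<Sum>k. \<Sum>w\<in>words J k. word_ratio r w ^ d * V (\<epsilon> / word_ratio r w))"
      by (simp add: R_def[abs_def] F_def[abs_def])
  qed
qed

end

text \<open>The sum over \<open>tiling_dims\<close> is read as the limit of finite sums over the
  points of height at most \<open>\<tau> n\<close>, with the same sequence for every \<epsilon>;
  absolute convergence of the residues is not asserted. An integer that is also a complex dimension
  occurs once in the union, with its full residue.\<close>

theorem theorem2:
  fixes J :: nat and r :: "nat \<Rightarrow> real"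
    and \<Phi> :: "nat \<Rightarrow> 'a::euclidean_space \<Rightarrow> 'a"
    and F C G :: "'a set"
    and D g h :: real and \<kappa> :: "nat \<Rightarrow> real" and lam :: "real \<Rightarrow> real"
  assumes ratios: "\<And>j. j \<in> {1..J} \<Longrightarrow> 0 < r j \<and> r j < 1"
    and similitudes: "\<And>j. j \<in> {1..J} \<Longrightarrow> similitude (r j) (\<Phi> j)"
    and attractor: "F \<noteq> {}" "compact F" "F = set_map J \<Phi> F"
    and hull: "C = convex hull F"
    and dim_hull: "aff_dim C = int DIM('a)"
    and osc: "\<And>j. j \<in> {1..J} \<Longrightarrow> \<Phi> j ` interior C \<subseteq> interior C"
      "disjoint_family_on (\<lambda>j. \<Phi> j ` interior C) {1..J}"
    and nontrivial: "\<not> interior C \<subseteq> (\<Union>j\<in>{1..J}. \<Phi> j ` C)"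
    and sim_dim: "(\<Sum>j=1..J. r j powr D) = 1" "real DIM('a) - 1 < D" "D < real DIM('a)"
    and generator: "G = tile J \<Phi> C 1" "connected G"
    and inradius: "g = inradius G"
    and h: "0 < h" "h \<le> g"
    and volume_small:
      "\<And>\<epsilon>. 0 < \<epsilon> \<Longrightarrow> \<epsilon> < h \<Longrightarrow> inner_volume G \<epsilon> = (\<Sum>i<DIM('a). \<kappa> i * \<epsilon> ^ (DIM('a) - i))"
    and volume_large:
      "\<And>\<epsilon>. h \<le> \<epsilon> \<Longrightarrow> \<epsilon> \<le> g \<Longrightarrow> inner_volume G \<epsilon> = lam \<epsilon>"
    and lam: "continuous_on {h..g} lam" "lam piecewise_C1_differentiable_on {h..g}"
  shows "\<exists>\<tau> :: nat \<Rightarrow> real.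
    (\<forall>n. real n \<le> \<tau> n \<and> \<tau> n \<le> real n + 1
         \<and> finite {\<omega> \<in> tiling_dims J r DIM('a). \<bar>Im \<omega>\<bar> \<le> \<tau> n}) \<and>
    (\<forall>\<epsilon>. 0 < \<epsilon> \<and> \<epsilon> < h \<longrightarrow>
      (\<lambda>n. \<Sum>\<omega> | \<omega> \<in> tiling_dims J r DIM('a) \<and> \<bar>Im \<omega>\<bar> \<le> \<tau> n.
              residue (\<lambda>s. geometric_zeta J r G h \<kappa> lam s \<epsilon>) \<omega>)
        \<longlonglongrightarrow> of_real (tiling_volume J \<Phi> C \<epsilon>))"
proof -
  \<comment> \<open>Lebesgue measure on the generator together with the distance to its frontier
    instantiates the abstract tube.\<close>
  define M where "M = restrict_space lborel G"
  define \<delta> where "\<delta> x = infdist x (frontier G)" for x :: 'a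
  have G: "G = interior (C - set_map J \<Phi> C)" using generator by (simp add: tile_def)
  have "compact C" unfolding hull by (rule compact_convex_hull[OF attractor(2)])
  then have "bounded C" by (rule compact_imp_bounded)
  have "open G" by (simp add: G)
  have "bounded G"
    using \<open>bounded C\<close> by (rule bounded_subset) (use interior_subset G in blast)
  have space_M: "space M = G"
    using \<open>open G\<close> by (simp add: M_def space_restrict_space)
  have measure_M: "measure M A = measure lebesgue A" if "A \<in> sets borel" "A \<subseteq> G" for A
    using that \<open>open G\<close> unfolding M_def
    by (subst measure_restrict_space) (auto simp: measure_completion)
  have \<delta>_borel: "\<delta> \<in> borel_measurable borel"
    unfolding \<delta>_def by (intro borel_measurable_continuous_onI continuous_intros)
  have borel_level: "{x \<in> G. \<delta> x \<le> u} \<in> sets borel" "{x \<in> G. \<delta> x = u} \<in> sets borel" for u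
    using \<delta>_borel borel_open[OF \<open>open G\<close>] by measurable
  have vol: "inner_volume G u = measure M {x \<in> space M. \<delta> x \<le> u}" for u
    unfolding space_M using borel_level(1) by (subst measure_M) (auto simp: inner_volume_def \<delta>_def)
  interpret finite_measure M
  proof (rule finite_measureI)
    have "emeasure M (space M) = emeasure lborel G"
      unfolding space_M unfolding M_def using \<open>open G\<close> by (subst emeasure_restrict_space) auto
    then show "emeasure M (space M) \<noteq> \<infinity>" using emeasure_bounded_finite[OF \<open>bounded G\<close>] by simp
  qed
  interpret tube: inner_tube M \<delta> "DIM('a)" g h \<kappa> lam
  proof unfold_locales
    show "\<delta> \<in> borel_measurable M"
      unfolding M_def by (rule measurable_restrict_space1) (use \<delta>_borel in simp)
    show "0 < \<delta> x" "\<delta> x \<le> g" if "x \<in> space M" for x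
      using infdist_frontier_le_inradius[OF \<open>open G\<close> \<open>bounded G\<close>, of x] that
      by (simp_all add: \<delta>_def space_M inradius)
    show "measure M {x \<in> space M. \<delta> x = u} = 0" if "0 < u" for u
    \<comment> \<open>The lemma on level sets asks for a nonempty frontier, which an empty set does
      not have.\<close>
    proof (cases "G = {}")
      case True
      then show ?thesis by (simp add: space_M)
    next
      case False
      then have "negligible {x. infdist x (frontier G) = u}"
        using \<open>bounded G\<close> \<open>0 < u\<close>
        by (intro negligible_infdist_level_set compact_frontier_bounded frontier_bounded_nonempty)
      then have neg: "negligible {x \<in> G. \<delta> x = u}"
        by (rule negligible_subset) (auto simp: \<delta>_def)
      have "measure M {x \<in> G. \<delta> x = u} = measure lebesgue {x \<in> G. \<delta> x = u}"
        by (rule measure_M[OF borel_level(2)]) auto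
      also have "\<dots> = 0" using neg by (rule negligible_imp_measure0)
      finally show ?thesis unfolding space_M .
    qed
  qed (use h lam volume_small volume_large in \<open>auto simp: vol\<close>)
  have zeta: "geometric_zeta J r G h \<kappa> lam s \<epsilon>
      = scaling_zeta J r s * of_real \<epsilon> powr (of_nat DIM('a) - s) * tube.bracket s" for s \<epsilon>
    unfolding geometric_zeta_def tube.bracket_def Let_def inradius[symmetric]
    using measure_M[of G] \<open>open G\<close> by (simp add: space_M)
  have volume: "tiling_volume J \<Phi> C \<epsilon>
      = (\<Sum>k. \<Sum>w\<in>words J k. word_ratio r w ^ DIM('a) * tube.V (\<epsilon> / word_ratio r w))" if "0 < \<epsilon>" for \<epsilon>
  proof -
    have "inner_volume (tile J \<Phi> C (Suc k)) \<epsilon>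
        = (\<Sum>w\<in>words J k. word_ratio r w ^ DIM('a) * inner_volume (tile J \<Phi> C 1) (\<epsilon> / word_ratio r w))" for k
      by (rule inner_volume_tile) (use ratios similitudes osc \<open>bounded C\<close> that in auto)
    then show ?thesis
      unfolding tiling_volume_def tube.V_def vol[symmetric] generator(1) by simp
  qed
  obtain \<tau> :: "nat \<Rightarrow> real" where \<tau>: "\<And>n. real n \<le> \<tau> n \<and> \<tau> n \<le> real n + 1"
    "\<And>\<epsilon>. 0 < \<epsilon> \<Longrightarrow> \<epsilon> < h \<Longrightarrow>
      (\<lambda>n. \<Sum>\<omega> | \<omega> \<in> tiling_dims J r DIM('a) \<and> \<bar>Im \<omega>\<bar> \<le> \<tau> n.
        residue (\<lambda>s. scaling_zeta J r s * of_real \<epsilon> powr (of_nat DIM('a) - s) * tube.bracket s) \<omega>)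
      \<longlonglongrightarrow> of_real (\<Sum>k. \<Sum>w\<in>words J k. word_ratio r w ^ DIM('a) * tube.V (\<epsilon> / word_ratio r w))"
    using tube.residue_sum_tendsto[OF ratios sim_dim] by blast
  show ?thesis
  proof (intro exI[of _ \<tau>] conjI allI impI)
    show "finite {\<omega> \<in> tiling_dims J r DIM('a). \<bar>Im \<omega>\<bar> \<le> \<tau> n}" for n
      by (rule finite_tiling_dims[OF ratios sim_dim(1)])
  qed (use \<tau> in \<open>auto simp: zeta volume\<close>)
qed

end
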